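(* Let $\mathcal{P}$ and $\mathcal{Q}$ be a pair of compactness-like topological properties. Let $X$ be a Tychonoff space with $\mathcal{Q}$. Then (1) $\mathscr{M}^{\mathcal Q}_{\mathcal P}(X)$ is the largest (with respect to inclusion) cofinal subset of $(\mathscr{E}^{\mathcal Q}_{\mathcal P}(X),\le)$ on which the two relations $\le$ and $\le_{surj}$ coincide. (2) $\mathscr{M}^{\mathcal Q}_{\mathcal P}(X)$ is the largest subset of $(\mathscr{E}^{\mathcal Q}_{\mathcal P}(X),\le_{surj})$ in which $\mathscr{O}^{\mathcal Q}_{\mathcal P}(X)$ is cofinal. (3) $\mathscr{M}^{\mathcal Q}_{\mathcal P}(X)$ is the largest subset $\mathscr E$ of $\mathscr{E}^{\mathcal Q}_{\mathcal P}(X)$ such that for all $S\in\mathscr E$ and $T\in\mathscr{E}^{\mathcal Q}_{\mathcal P}(X)$, $S\le T$ implies $S\le_{surj}T$. (4) $\mathscr{M}^{\mathcal Q}_{\mathcal P}(X)$ is the smallest cofinal subset $\mathscr E$ of $(\mathscr{E}^{\mathcal Q}_{\mathcal P}(X),\le)$ such that for all $S\in\mathscr{E}^{\mathcal Q}_{\mathcal P}(X)$ and $T\in\mathscr E$, $S\le_{surj}T$ implies $S\in\mathscr E$.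
   Context: Conventions: compact spaces and Tychonoff spaces are Hausdorff. Topological properties are assumed to be satisfied by at least one space. A mapping $f:X\to Y$ is perfect if $X$ is Hausdorff and $f$ is continuous, closed (not necessarily surjective) and has compact fibers. A topological property $\mathcal{P}$ is invariant (inverse invariant) under perfect mappings if for every perfect surjective $f:X\to Y$, $Y$ has $\mathcal P$ whenever $X$ does ($X$ has $\mathcal P$ whenever $Y$ does); it is perfect if both hold. $\mathcal P$ is clopen hereditary if every clopen subset of a space with $\mathcal P$ has $\mathcal P$; finitely additive if $X_1\oplus\cdots\oplus X_n$ has $\mathcal P$ whenever every $X_i$ does. $\mathcal P$ satisfies Mrówka's condition (W) if: whenever $X$ is a Tychonoff space having a point $p$ with an open base $\mathscr B$ for $X$ at $p$ such that $X\setminus B$ has $\mathcal P$ for every $B\in\mathscr B$, then $X$ has $\mathcal P$. $\mathcal P$ is compactness-like if it is clopen hereditary, finitely additive, perfect and satisfies (W). "$\mathcal P$ and $\mathcal Q$ is a pair of compactness-like topological properties" (order matters) means: $\mathcal P$ is compactness-like, and $\mathcal Q$ is clopen hereditary, inverse invariant under perfect mappings and satisfies (W). A space $Y$ is an extension of $X$ if it contains $X$ as a dense subspace; $Y\setminus X$ is its remainder. Extensions are identified (considered equal) when there is a homeomorphism between them fixing $X$ pointwise. $Y\le Y'$ ($Y\le_{surj}Y'$) means there is a continuous (continuous surjective) map $Y'\to Y$ fixing $X$ pointwise. $\mathscr E(X)$ is the set of all Tychonoff extensions of $X$ with compact remainder; $\mathscr E_{\mathcal P}(X)=\mathscr E^{\mathcal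 P}(X)$ is the set of elements of $\mathscr E(X)$ having $\mathcal P$; $\mathscr E^{\mathcal Q}_{\mathcal P}(X)=\mathscr E^{\mathcal Q}(X)\cap\mathscr E_{\mathcal P}(X)$. A minimal $\mathcal P$-extension of $X$ is a $Y\in\mathscr E_{\mathcal P}(X)$ which does not properly contain (as a subspace) any other element of $\mathscr E_{\mathcal P}(X)$. An optimal $\mathcal P$-extension of $X$ is a minimal $\mathcal P$-extension $Y$ whose topology is moreover maximal (with respect to inclusion) among all topologies on the set $Y$ which turn $Y$ into an element of $\mathscr E_{\mathcal P}(X)$. $\mathscr M_{\mathcal P}(X)$, $\mathscr O_{\mathcal P}(X)$ are the sets of minimal, respectively optimal, $\mathcal P$-extensions; $\mathscr M^{\mathcal Q}_{\mathcal P}(X)=\mathscr E^{\mathcal Q}(X)\cap\mathscr M_{\mathcal P}(X)$ and $\mathscr O^{\mathcal Q}_{\mathcal P}(X)=\mathscr E^{\mathcal Q}(X)\cap\mathscr O_{\mathcal P}(X)$. A subset $A$ of a partially ordered set $(L,\le)$ is cofinal in $L$ if $A\subseteq L$ and for any $x\in L$ there is $a\in A$ with $x\le a$. *)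

theory Defs
  imports "HOL-Analysis.Analysis"
begin

section \<open>Topological properties\<close>

text \<open>
  HOL has no quantification over types, so "all topological spaces" is read as "all topologies
  on subsets of a universe type \<^typ>\<open>'u\<close>", and a topological property is a predicate on
  \<^typ>\<open>'u topology\<close>.  A property of all spaces restricts to such a predicate, and
  all closure conditions below are only demanded for spaces inside \<^typ>\<open>'u\<close>.
\<close>

definition topological_property :: "('u topology \<Rightarrow> bool) \<Rightarrow> bool" where
  "topological_property P \<longleftrightarrow>
     (\<exists>X. P X) \<and> (\<forall>X Y. X homeomorphic_space Y \<longrightarrow> P X \<longrightarrow> P Y)"

definition tychonoff_space :: "'a topology \<Rightarrow> bool" where
  "tychonoff_space X \<longleftrightarrow> completely_regular_space X \<and> Hausdorff_space X"

definition clopen_hereditary :: "('u topology \<Rightarrow> bool) \<Rightarrow> bool" where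
  "clopen_hereditary P \<longleftrightarrow>
     (\<forall>X U. P X \<and> openin X U \<and> closedin X U \<longrightarrow> P (subtopology X U))"

text \<open>
  \<^const>\<open>sum_topology\<close> lives on \<^typ>\<open>nat \<times> 'u\<close>, so the condition is put on the
  spaces over \<^typ>\<open>'u\<close> that are homeomorphic to the topological sum.
\<close>
definition finitely_additive :: "('u topology \<Rightarrow> bool) \<Rightarrow> bool" where
  "finitely_additive P \<longleftrightarrow>
     (\<forall>(n::nat) X Z. n \<ge> 1 \<and> (\<forall>i\<in>{1..n}. P (X i)) \<and>
        Z homeomorphic_space (sum_topology X {1..n}) \<longrightarrow> P Z)"

text \<open>\<^const>\<open>perfect_map\<close> already includes surjectivity, but not that the domain is Hausdorff.\<close>

definition perfect_invariant :: "('u topology \<Rightarrow> bool) \<Rightarrow> bool" where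
  "perfect_invariant P \<longleftrightarrow>
     (\<forall>X Y f. Hausdorff_space X \<and> perfect_map X Y f \<and> P X \<longrightarrow> P Y)"

definition perfect_inverse_invariant :: "('u topology \<Rightarrow> bool) \<Rightarrow> bool" where
  "perfect_inverse_invariant P \<longleftrightarrow>
     (\<forall>X Y f. Hausdorff_space X \<and> perfect_map X Y f \<and> P Y \<longrightarrow> P X)"

definition perfect_property :: "('u topology \<Rightarrow> bool) \<Rightarrow> bool" where
  "perfect_property P \<longleftrightarrow> perfect_invariant P \<and> perfect_inverse_invariant P"

definition open_base_at :: "'a topology \<Rightarrow> 'a \<Rightarrow> 'a set set \<Rightarrow> bool" where
  "open_base_at X p \<B> \<longleftrightarrow>
     (\<forall>B\<in>\<B>. openin X B \<and> p \<in> B) \<and>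
     (\<forall>U. openin X U \<and> p \<in> U \<longrightarrow> (\<exists>B\<in>\<B>. B \<subseteq> U))"

definition mrowka_W :: "('u topology \<Rightarrow> bool) \<Rightarrow> bool" where
  "mrowka_W P \<longleftrightarrow>
     (\<forall>X. tychonoff_space X \<and>
        (\<exists>p\<in>topspace X. \<exists>\<B>. open_base_at X p \<B> \<and>
            (\<forall>B\<in>\<B>. P (subtopology X (topspace X - B)))) \<longrightarrow> P X)"

definition compactness_like :: "('u topology \<Rightarrow> bool) \<Rightarrow> bool" where
  "compactness_like P \<longleftrightarrow> topological_property P \<and>
     clopen_hereditary P \<and> finitely_additive P \<and> perfect_property P \<and> mrowka_W P"

definition compactness_like_pair ::
    "('u topology \<Rightarrow> bool) \<Rightarrow> ('u topology \<Rightarrow> bool) \<Rightarrow> bool" where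
  "compactness_like_pair P Q \<longleftrightarrow> compactness_like P \<and>
     topological_property Q \<and> clopen_hereditary Q \<and> perfect_inverse_invariant Q \<and> mrowka_W Q"


section \<open>Extensions with compact remainder\<close>

definition extension_of :: "'u topology \<Rightarrow> 'u topology \<Rightarrow> bool" where
  "extension_of X Y \<longleftrightarrow> topspace X \<subseteq> topspace Y \<and>
     subtopology Y (topspace X) = X \<and> Y closure_of (topspace X) = topspace Y"

text \<open>
  The prefix \<open>rep\<close> marks sets of concrete extensions, before the identification of extensions
  that are homeomorphic by a map fixing \<open>X\<close> pointwise.
\<close>

definition rep_E :: "'u topology \<Rightarrow> 'u topology set" where
  "rep_E X = {Y. extension_of X Y \<and> tychonoff_space Y \<and> compactin Y (topspace Y - topspace X)}"

definition rep_E_prop :: "('u topology \<Rightarrow> bool) \<Rightarrow> 'u topology \<Rightarrow> 'u topology set" where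
  "rep_E_prop P X = {Y \<in> rep_E X. P Y}"

definition rep_M :: "('u topology \<Rightarrow> bool) \<Rightarrow> 'u topology \<Rightarrow> 'u topology set" where
  "rep_M P X = {Y \<in> rep_E_prop P X.
     \<not> (\<exists>Z \<in> rep_E_prop P X. topspace Z \<subset> topspace Y \<and> subtopology Y (topspace Z) = Z)}"

definition rep_O :: "('u topology \<Rightarrow> bool) \<Rightarrow> 'u topology \<Rightarrow> 'u topology set" where
  "rep_O P X = {Y \<in> rep_M P X.
     \<forall>Z \<in> rep_E_prop P X. topspace Z = topspace Y \<and> (\<forall>U. openin Y U \<longrightarrow> openin Z U) \<longrightarrow> Z = Y}"

definition ext_equiv :: "'u topology \<Rightarrow> ('u topology \<times> 'u topology) set" where
  "ext_equiv X = {(Y, Z). Y \<in> rep_E X \<and> Z \<in> rep_E X \<and>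
     (\<exists>h. homeomorphic_map Y Z h \<and> (\<forall>x\<in>topspace X. h x = x))}"

lemma equiv_ext_equiv: "equiv (rep_E X) (ext_equiv X)"
proof (rule equivI)
  show "ext_equiv X \<subseteq> rep_E X \<times> rep_E X"
    by (auto simp: ext_equiv_def)
  show "refl_on (rep_E X) (ext_equiv X)"
    unfolding refl_on_def ext_equiv_def
    by (auto intro!: exI[of _ "\<lambda>x. x"] simp: homeomorphic_map_id[unfolded id_def])
  show "sym (ext_equiv X)"
  proof (rule symI)
    fix Y Z assume a: "(Y, Z) \<in> ext_equiv X"
    then obtain h where h: "homeomorphic_map Y Z h" "\<forall>x\<in>topspace X. h x = x"
      by (auto simp: ext_equiv_def)
    then obtain g where g: "homeomorphic_maps Y Z h g"
      by (auto simp: homeomorphic_map_maps)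
    have "topspace X \<subseteq> topspace Y"
      using a by (auto simp: ext_equiv_def rep_E_def extension_of_def)
    then have "\<forall>x\<in>topspace X. g x = x"
      using g h(2) unfolding homeomorphic_maps_def by (metis subsetD)
    moreover have "homeomorphic_map Z Y g"
      using g homeomorphic_maps_map by blast
    ultimately show "(Z, Y) \<in> ext_equiv X"
      using a by (auto simp: ext_equiv_def)
  qed
  show "trans (ext_equiv X)"
  proof (rule transI)
    fix A B C assume ab: "(A, B) \<in> ext_equiv X" and bc: "(B, C) \<in> ext_equiv X"
    obtain h k where "homeomorphic_map A B h" "\<forall>x\<in>topspace X. h x = x"
        "homeomorphic_map B C k" "\<forall>x\<in>topspace X. k x = x"
      using ab bc by (auto simp: ext_equiv_def)
    then have "homeomorphic_map A C (k \<circ> h) \<and> (\<forall>x\<in>topspace X. (k \<circ> h) x = x)"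
      by (auto intro: homeomorphic_map_compose)
    then show "(A, C) \<in> ext_equiv X"
      using ab bc unfolding ext_equiv_def by blast
  qed
qed

text \<open>From here on an extension is a class of \<^const>\<open>ext_equiv\<close>.\<close>

definition E_prop :: "('u topology \<Rightarrow> bool) \<Rightarrow> 'u topology \<Rightarrow> 'u topology set set" where
  "E_prop P X = rep_E_prop P X // ext_equiv X"

definition M_prop :: "('u topology \<Rightarrow> bool) \<Rightarrow> 'u topology \<Rightarrow> 'u topology set set" where
  "M_prop P X = rep_M P X // ext_equiv X"

definition O_prop :: "('u topology \<Rightarrow> bool) \<Rightarrow> 'u topology \<Rightarrow> 'u topology set set" where
  "O_prop P X = rep_O P X // ext_equiv X"

definition E_pair ::
    "('u topology \<Rightarrow> bool) \<Rightarrow> ('u topology \<Rightarrow> bool) \<Rightarrow> 'u topology \<Rightarrow> 'u topology set set" where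
  "E_pair P Q X = E_prop Q X \<inter> E_prop P X"

definition M_pair ::
    "('u topology \<Rightarrow> bool) \<Rightarrow> ('u topology \<Rightarrow> bool) \<Rightarrow> 'u topology \<Rightarrow> 'u topology set set" where
  "M_pair P Q X = E_prop Q X \<inter> M_prop P X"

definition O_pair ::
    "('u topology \<Rightarrow> bool) \<Rightarrow> ('u topology \<Rightarrow> bool) \<Rightarrow> 'u topology \<Rightarrow> 'u topology set set" where
  "O_pair P Q X = E_prop Q X \<inter> O_prop P X"

definition ext_le :: "'u topology \<Rightarrow> 'u topology set \<Rightarrow> 'u topology set \<Rightarrow> bool" where
  "ext_le X S T \<longleftrightarrow> (\<exists>Y\<in>S. \<exists>Z\<in>T. \<exists>f.
     continuous_map Z Y f \<and> (\<forall>x\<in>topspace X. f x = x))"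

definition ext_le_surj :: "'u topology \<Rightarrow> 'u topology set \<Rightarrow> 'u topology set \<Rightarrow> bool" where
  "ext_le_surj X S T \<longleftrightarrow> (\<exists>Y\<in>S. \<exists>Z\<in>T. \<exists>f.
     continuous_map Z Y f \<and> f ` topspace Z = topspace Y \<and> (\<forall>x\<in>topspace X. f x = x))"


section \<open>Cofinal, largest and smallest subsets\<close>

definition cofinal_in :: "('b \<Rightarrow> 'b \<Rightarrow> bool) \<Rightarrow> 'b set \<Rightarrow> 'b set \<Rightarrow> bool" where
  "cofinal_in le L A \<longleftrightarrow> A \<subseteq> L \<and> (\<forall>x\<in>L. \<exists>a\<in>A. le x a)"

definition largest_set :: "('b set \<Rightarrow> bool) \<Rightarrow> 'b set \<Rightarrow> bool" where
  "largest_set \<Phi> M \<longleftrightarrow> \<Phi> M \<and> (\<forall>A. \<Phi> A \<longrightarrow> A \<subseteq> M)"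

definition smallest_set :: "('b set \<Rightarrow> bool) \<Rightarrow> 'b set \<Rightarrow> bool" where
  "smallest_set \<Phi> M \<longleftrightarrow> \<Phi> M \<and> (\<forall>A. \<Phi> A \<longrightarrow> M \<subseteq> A)"

end

theory Submission
  imports Defs
begin

text \<open>
  Closed heredity follows from clopen heredity and
  inverse invariance, since \<open>A \<oplus> X \<rightarrow> X\<close> is perfect for closed \<open>A\<close>; collapsing the compact
  remainder to a point and using condition (W) then shows that an extension \<open>Y\<close> with compact
  remainder has \<open>P\<close> iff every closed subset of \<open>Y\<close> inside \<open>X\<close> has \<open>P\<close>.  In particular all such
  extensions inherit \<open>Q\<close> from \<open>X\<close>, so \<open>Q\<close> drops out.

  Having \<open>P\<close> thus depends only on how the ideal of closed subsets of \<open>X\<close> with \<open>P\<close> meets the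
  topology of \<open>Y\<close>, and it passes to every extension below \<open>Y\<close>.  Hence a map from an extension with \<open>P\<close>
  to a minimal one is onto, its image being a subextension with \<open>P\<close>, while a non-minimal \<open>Y\<close> is
  strictly below its proper subextension for \<open>\<le>\<close> but not for \<open>\<le>\<^sub>s\<^sub>u\<^sub>r\<^sub>j\<close>.  By compactness of the
  remainder, Zorn's lemma gives minimal subextensions and maximal finer topologies.  Minimality is
  inherited downwards along surjections, and the four characterisations follow formally.
\<close>

section \<open>Closed subsets and topological properties\<close>

text \<open>One construction serves two ends: an injective \<open>g\<close> copies a space into
  another type, and a \<open>g\<close> that collapses a compact set gives the quotient by that
  set.\<close>

definition quotient_topology :: "'a topology \<Rightarrow> ('a \<Rightarrow> 'b) \<Rightarrow> 'b topology" where
  "quotient_topology W g =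
     topology (\<lambda>U. U \<subseteq> g ` topspace W \<and> openin W {x \<in> topspace W. g x \<in> U})"

lemma openin_quotient_topology:
  "openin (quotient_topology W g) U \<longleftrightarrow>
     U \<subseteq> g ` topspace W \<and> openin W {x \<in> topspace W. g x \<in> U}"
proof -
  have "istopology (\<lambda>U. U \<subseteq> g ` topspace W \<and> openin W {x \<in> topspace W. g x \<in> U})"
    unfolding istopology_def
  proof (intro conjI allI impI)
    fix S T
    assume S: "S \<subseteq> g ` topspace W \<and> openin W {x \<in> topspace W. g x \<in> S}"
      and T: "T \<subseteq> g ` topspace W \<and> openin W {x \<in> topspace W. g x \<in> T}"
    have "{x \<in> topspace W. g x \<in> S \<inter> T} = {x \<in> topspace W. g x \<in> S} \<inter> {x \<in> topspace W. g x \<in> T}"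
      by auto
    then show "openin W {x \<in> topspace W. g x \<in> S \<inter> T}"
      using S T by auto
  next
    fix \<K>
    assume K: "\<forall>K\<in>\<K>. K \<subseteq> g ` topspace W \<and> openin W {x \<in> topspace W. g x \<in> K}"
    have "{x \<in> topspace W. g x \<in> \<Union>\<K>} = (\<Union>K\<in>\<K>. {x \<in> topspace W. g x \<in> K})"
      by auto
    then show "openin W {x \<in> topspace W. g x \<in> \<Union>\<K>}"
      using K by auto
  qed auto
  then show ?thesis
    by (simp add: quotient_topology_def)
qed

lemma topspace_quotient_topology [simp]: "topspace (quotient_topology W g) = g ` topspace W"
proof -
  have "{x \<in> topspace W. g x \<in> g ` topspace W} = topspace W"
    by auto
  then have "openin (quotient_topology W g) (g ` topspace W)"
    by (simp add: openin_quotient_topology)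
  then show ?thesis
    by (metis openin_quotient_topology openin_subset openin_topspace subset_antisym)
qed

lemma quotient_map_quotient_topology: "quotient_map W (quotient_topology W g) g"
  by (auto simp: quotient_map_def openin_quotient_topology)

text \<open>An injective quotient map is a homeomorphism, so an injection of the points carries the
  topology along.\<close>

lemma lepoll_imp_homeomorphic_copy:
  assumes "topspace W \<lesssim> (UNIV :: 'u set)"
  obtains Z :: "'u topology" where "W homeomorphic_space Z"
proof -
  obtain g :: "'a \<Rightarrow> 'u" where "inj_on g (topspace W)"
    using assms by (auto simp: lepoll_def)
  then have "homeomorphic_map W (quotient_topology W g) g"
    by (simp add: homeomorphic_map_def quotient_map_quotient_topology)
  then show thesis
    using that homeomorphic_map_imp_homeomorphic_space by blast
qed

text \<open>An infinite cardinal dominates that of \<open>nat\<close> and equals its own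
  square.\<close>

lemma infinite_nat_times_lepoll:
  assumes "infinite (UNIV :: 'u set)"
  shows "(A :: (nat \<times> 'u) set) \<lesssim> (UNIV :: 'u set)"
proof -
  have "(UNIV :: nat set) \<lesssim> (UNIV :: 'u set)"
    using assms infinite_le_lepoll by blast
  then have "(UNIV :: nat set) \<times> (UNIV :: 'u set) \<lesssim> (UNIV :: 'u set) \<times> (UNIV :: 'u set)"
    by (intro times_lepoll_mono) auto
  also have "\<dots> \<lesssim> (UNIV :: 'u set)"
    using card_of_Times_same_infinite[OF assms] 
    by (metis card_of_ordIso eqpoll_def eqpoll_imp_lepoll)
  finally show ?thesis
    by (metis UNIV_Times_UNIV lepoll_trans subset_UNIV subset_imp_lepoll)
qed

text \<open>The sum is copied into \<^typ>\<open>'u\<close>, because the closure conditions on a property only speak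
  about spaces over that type.\<close>
lemma sum_of_closed_subsets:
  fixes W :: "'u topology"
  defines "\<Sigma> A B \<equiv> sum_topology (\<lambda>i::nat. subtopology W (if i = 1 then A else B)) {1..2}"
  assumes inf: "infinite (UNIV :: 'u set)" and W: "Hausdorff_space W"
    and A: "closedin W A" and B: "closedin W B"
  obtains Z :: "'u topology" and f U where "Z homeomorphic_space \<Sigma> A B" "Hausdorff_space Z"
    "perfect_map Z (subtopology W (A \<union> B)) f" "openin Z U" "closedin Z U"
    "subtopology Z U homeomorphic_space subtopology W A"
proof -
  let ?S = "\<Sigma> A B"
  have AB: "A \<subseteq> topspace W" "B \<subseteq> topspace W"
    using A B closedin_subset by auto
  have ts: "topspace ?S = {1} \<times> A \<union> {2} \<times> B"
    using AB unfolding \<Sigma>_def by (auto simp: less_Suc_eq_le numeral_2_eq_2 le_Suc_eq split: if_splits)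
  obtain Z :: "'u topology" where Z: "?S homeomorphic_space Z"
    using lepoll_imp_homeomorphic_copy infinite_nat_times_lepoll[OF inf] by blast
  then obtain g h where gh: "homeomorphic_maps ?S Z g h"
    by (auto simp: homeomorphic_space_def)
  have I: "{1..2} = {1, 2::nat}" by auto
  \<comment> \<open>Closedness in the sum is tested on the two slices. As \<open>A\<close> and
    \<open>B\<close> are closed in \<open>W\<close>, the test takes place in \<open>W\<close>
    itself, and the checks below become statements about \<open>W\<close>.\<close>
  have cl: "closedin ?S C \<longleftrightarrow> C \<subseteq> topspace ?S \<and> closedin W {x. (1, x) \<in> C} \<and> closedin W {x. (2, x) \<in> C}" for C
  proof -
    have "closedin ?S C \<longleftrightarrow> C \<subseteq> topspace ?S \<and> closedin (subtopology W A) {x. (1, x) \<in> C} \<and>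
        closedin (subtopology W B) {x. (2, x) \<in> C}"
      unfolding topspace_sum_topology \<Sigma>_def closedin_sum_topology I by simp
    moreover have "{x. (1, x) \<in> C} \<subseteq> A" "{x. (2, x) \<in> C} \<subseteq> B" if "C \<subseteq> topspace ?S"
      using that unfolding ts by auto
    ultimately show ?thesis
      using A B by (auto simp: closedin_closed_subtopology)
  qed
  have snd_cont: "continuous_map ?S (subtopology W (A \<union> B)) snd"
    unfolding continuous_map_closedin
  proof (intro conjI ballI allI impI)
    fix C assume "closedin (subtopology W (A \<union> B)) C"
    then have C: "closedin W C" "C \<subseteq> A \<union> B"
      using A B by (auto simp: closedin_closed_subtopology closedin_Un)
    have "{x. (1, x) \<in> {x \<in> topspace ?S. snd x \<in> C}} = A \<inter> C" 
         "{x. (2, x) \<in> {x \<in> topspace ?S. snd x \<in> C}} = B \<inter> C"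
      using ts by auto
    then show "closedin ?S {x \<in> topspace ?S. snd x \<in> C}"
      using A B C by (auto simp: cl)
  qed (use ts AB in auto)
  have snd_closed: "closed_map ?S (subtopology W (A \<union> B)) snd"
    unfolding closed_map_def
  proof (intro allI impI)
    fix C assume C: "closedin ?S C"
    then have "snd ` C = {x. (1, x) \<in> C} \<union> {x. (2, x) \<in> C}" "snd ` C \<subseteq> A \<union> B"
      unfolding cl ts by force+
    then show "closedin (subtopology W (A \<union> B)) (snd ` C)"
      using C A B by (auto simp: cl closedin_closed_subtopology closedin_Un)
  qed
  have "perfect_map ?S (subtopology W (A \<union> B)) snd"
    unfolding perfect_map_def proper_map_def
  proof (intro conjI ballI)
    fix y
    have "{x \<in> topspace ?S. snd x = y} \<subseteq> {(1, y), (2, y)}"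
      unfolding ts by auto
    then have "finite {x \<in> topspace ?S. snd x = y}"
      using finite_subset by blast
    then show "compactin ?S {x \<in> topspace ?S. snd x = y}"
      by (intro finite_imp_compactin) auto
    show "snd ` topspace ?S = topspace (subtopology W (A \<union> B))"
    proof -
      have "topspace (subtopology W (A \<union> B)) = A \<union> B"
        using AB by auto
      then show ?thesis
        by (simp add: ts image_Un)
    qed
  qed (auto simp: snd_cont snd_closed)
  moreover have "homeomorphic_map Z ?S h"
    using gh homeomorphic_maps_map by blast
  ultimately have "perfect_map Z (subtopology W (A \<union> B)) (snd \<circ> h)"
    using homeomorphic_imp_perfect_map perfect_map_compose by blast
  moreover have "Hausdorff_space ?S"
  proof -
    \<comment> \<open>The sum maps injectively and continuously into the product of a discrete space
      with \<open>W\<close>, so it inherits the Hausdorff property from there.\<close>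
    have "continuous_map ?S (prod_topology (discrete_topology UNIV) W) id"
      unfolding continuous_map_pairwise
    proof
      show "continuous_map ?S W (snd \<circ> id)"
        using snd_cont by (simp add: continuous_map_in_subtopology)
      show "continuous_map ?S (discrete_topology UNIV) (fst \<circ> id)"
        unfolding continuous_map_closedin
      proof (intro conjI ballI allI impI)
        fix C :: "nat set"
        have "{x. (1, x) \<in> {x \<in> topspace ?S. (fst \<circ> id) x \<in> C}} = (if 1 \<in> C then A else {})"
          "{x. (2, x) \<in> {x \<in> topspace ?S. (fst \<circ> id) x \<in> C}} = (if 2 \<in> C then B else {})"
          using ts by auto
        then show "closedin ?S {x \<in> topspace ?S. (fst \<circ> id) x \<in> C}"
          using A B unfolding cl by (metis (no_types, lifting) closedin_empty mem_Collect_eq subsetI)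
      qed auto
    qed
    moreover have "Hausdorff_space (prod_topology (discrete_topology (UNIV :: nat set)) W)"
      using W by (simp add: Hausdorff_space_prod_topology Hausdorff_space_discrete_topology)
    ultimately show ?thesis
      using Hausdorff_space_injective_preimage by (metis inj_on_id)
  qed
  then have "Hausdorff_space Z"
    using Z homeomorphic_Hausdorff_space by blast
  moreover have "openin Z (g ` ({1} \<times> A))" "closedin Z (g ` ({1} \<times> A))"
    "subtopology Z (g ` ({1} \<times> A)) homeomorphic_space subtopology W A"
  proof -
    have g: "homeomorphic_map ?S Z g"
      using gh homeomorphic_maps_map by blast
    have "topspace ?S - {2} \<times> B = {1} \<times> A"
      unfolding ts by auto
    moreover have "closedin ?S ({2} \<times> B)"
      using A B unfolding cl ts by auto
    ultimately have "openin ?S ({1} \<times> A)"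
      by (metis openin_diff openin_topspace)
    moreover have "closedin ?S ({1} \<times> A)"
      using A B unfolding cl ts by auto
    ultimately show "openin Z (g ` ({1} \<times> A))" "closedin Z (g ` ({1} \<times> A))"
      using g homeomorphic_imp_open_map homeomorphic_imp_closed_map
      unfolding open_map_def closed_map_def by blast+
    have "subtopology ?S ({1} \<times> A) homeomorphic_space subtopology Z (g ` ({1} \<times> A))"
      using homeomorphic_map_subtopologies[OF g, of "{1} \<times> A" "g ` ({1} \<times> A)"] g ts
      by (metis (no_types, lifting) Un_upper1 homeomorphic_imp_surjective_map homeomorphic_map_imp_homeomorphic_space image_mono inf.absorb_iff2)
    moreover have "subtopology W A homeomorphic_space subtopology ?S ({1} \<times> A)"
    proof -
      have "embedding_map (subtopology W (if (1::nat) = 1 then A else B)) ?S (\<lambda>x. (1, x))"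
        unfolding \<Sigma>_def by (rule embedding_map_component_injection[of "1::nat"]) auto
      moreover have "(\<lambda>x. (1::nat, x)) ` topspace (subtopology W A) = {1} \<times> A"
        using AB by auto
      ultimately show ?thesis
        unfolding embedding_map_def using homeomorphic_map_imp_homeomorphic_space by fastforce
    qed
    ultimately show "subtopology Z (g ` ({1} \<times> A)) homeomorphic_space subtopology W A"
      using homeomorphic_space_trans homeomorphic_space_sym by metis
  qed
  ultimately show thesis
    using that Z homeomorphic_space_sym by metis
qed

section \<open>Closed heredity and closed unions\<close>

text \<open>The sum of \<open>A\<close> and \<open>W\<close> maps perfectly onto \<open>W\<close>,
  so it has \<open>P\<close> by inverse invariance; its clopen summand \<open>A\<close> then has
  \<open>P\<close> too.\<close>

lemma property_closed_subspace:
  fixes P :: "'u topology \<Rightarrow> bool"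
  assumes inf: "infinite (UNIV :: 'u set)" and "topological_property P" "clopen_hereditary P"
    "perfect_inverse_invariant P" and W: "Hausdorff_space W" "P W" and A: "closedin W A"
  shows "P (subtopology W A)"
proof -
  obtain Z :: "'u topology" and f U where "Hausdorff_space Z"
    "perfect_map Z (subtopology W (A \<union> topspace W)) f" "openin Z U" "closedin Z U"
    "subtopology Z U homeomorphic_space subtopology W A"
    using sum_of_closed_subsets[OF inf W(1) A closedin_topspace] by metis
  moreover have "subtopology W (A \<union> topspace W) = W"
    using A closedin_subset by (metis subtopology_topspace sup.absorb2)
  ultimately show ?thesis
    using assms unfolding topological_property_def clopen_hereditary_def perfect_inverse_invariant_def
    by metis
qed

text \<open>The sum of the two pieces has \<open>P\<close> by additivity, and it maps perfectly onto
  their union.\<close>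

lemma property_union_closed:
  fixes P :: "'u topology \<Rightarrow> bool"
  assumes inf: "infinite (UNIV :: 'u set)" and fa: "finitely_additive P" and pi: "perfect_invariant P"
    and W: "Hausdorff_space W" and A: "closedin W A" "P (subtopology W A)"
    and B: "closedin W B" "P (subtopology W B)"
  shows "P (subtopology W (A \<union> B))"
proof -
  obtain Z :: "'u topology" and f where Z: "Hausdorff_space Z"
    "perfect_map Z (subtopology W (A \<union> B)) f"
    "Z homeomorphic_space sum_topology (\<lambda>i::nat. subtopology W (if i = 1 then A else B)) {1..2}"
    using sum_of_closed_subsets[OF inf W A(1) B(1)] by metis
  have "\<forall>i\<in>{1..2::nat}. P (subtopology W (if i = 1 then A else B))"
    using A B by auto
  then have "P Z"
    using fa Z(3) unfolding finitely_additive_def by (metis one_le_numeral)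
  then show ?thesis
    using pi Z unfolding perfect_invariant_def by blast
qed

section \<open>Collapsing a compact set and condition (W)\<close>

text \<open>Prepares the use of (W): the compact set becomes a single point \<open>p\<close>, and
  closed sets that avoid \<open>p\<close> keep their subspace topology. The quotient stays Tychonoff
  because a compact set can be separated from closed sets by real functions.\<close>

lemma collapse_compact:
  fixes Y :: "'u topology"
  assumes Y: "tychonoff_space Y" and K: "compactin Y K" and p: "p \<in> K"
  obtains Z :: "'u topology" and f where "tychonoff_space Z" "perfect_map Y Z f" "p \<in> topspace Z"
    "\<And>C. closedin Z C \<Longrightarrow> p \<notin> C \<Longrightarrow>
      closedin Y C \<and> C \<inter> K = {} \<and> subtopology Z C = subtopology Y C"
proof -
  \<comment> \<open>Using a point of \<open>K\<close> as the collapsed point keeps the quotient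
    inside the type \<open>'u\<close>.\<close>
  define f where "f = (\<lambda>y. if y \<in> K then p else y)"
  define Z where "Z = quotient_topology Y f"
  have HY: "Hausdorff_space Y" and RY: "completely_regular_space Y"
    using Y by (auto simp: tychonoff_space_def)
  have KY: "K \<subseteq> topspace Y" "closedin Y K"
    using K HY compactin_subset_topspace compactin_imp_closedin by auto
  have q: "quotient_map Y Z f"
    unfolding Z_def by (rule quotient_map_quotient_topology)
  have ts: "topspace Z = f ` topspace Y"
    unfolding Z_def by simp
  have fY: "f y \<in> topspace Y" if "y \<in> topspace Y" for y
    using that p KY by (auto simp: f_def)
  have pre: "closedin Y {x \<in> topspace Y. f x \<in> D}" if "closedin Z D" for D
    using closedin_continuous_map_preimage[OF quotient_imp_continuous_map[OF q] that] by simp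
  have clZ: "closedin Z D \<longleftrightarrow> D \<subseteq> topspace Z \<and> closedin Y {x \<in> topspace Y. f x \<in> D}" for D
    using q closedin_subset unfolding quotient_map_closedin by metis
  have "closed_map Y Z f"
    unfolding closed_map_def
  proof (intro allI impI)
    fix C assume C: "closedin Y C"
    \<comment> \<open>Saturating a closed set adds either nothing or all of the closed set
      \<open>K\<close>, so the result is closed.\<close>
    then have "{x \<in> topspace Y. f x \<in> f ` C} = (if C \<inter> K = {} then C else C \<union> K)"
      using closedin_subset[OF C] KY p by (auto simp: f_def split: if_splits)
    then show "closedin Z (f ` C)"
      using C KY closedin_subset[OF C] unfolding clZ ts by auto
  qed
  moreover have "compactin Y {x \<in> topspace Y. f x = y}" if "y \<in> topspace Z" for y
  proof (cases "y = p")
    case True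
    then have "{x \<in> topspace Y. f x = y} = K"
      using KY p by (auto simp: f_def)
    then show ?thesis using K by simp
  next
    case False
    then have "{x \<in> topspace Y. f x = y} \<subseteq> {y}"
      by (auto simp: f_def split: if_splits)
    then show ?thesis
      by (metis (no_types, lifting) finite.emptyI finite.insertI finite_imp_compactin finite_subset mem_Collect_eq subsetI)
  qed
  ultimately have perf: "perfect_map Y Z f"
    using q quotient_imp_continuous_map ts by (auto simp: perfect_map_def proper_map_def)
  have "completely_regular_space Z"
    unfolding completely_regular_space_alt
  proof (intro allI impI)
    fix S x assume S: "closedin Z S" and x: "x \<in> topspace Z - S"
    let ?S = "{x \<in> topspace Y. f x \<in> S}"
    \<comment> \<open>A function that is constant on \<open>K\<close> descends to the quotient. At
      \<open>x = p\<close> it is chosen to be 0 on all of \<open>K\<close>; at any other point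
      \<open>K\<close> joins the closed set on which it is 1.\<close>
    have "\<exists>g c. continuous_map Y euclideanreal g \<and> g x = 0 \<and> g ` ?S \<subseteq> {1} \<and> g ` K \<subseteq> {c}"
    proof (cases "x = p")
      case True
      then have "disjnt K ?S"
        using x by (auto simp: disjnt_def f_def)
      then obtain g where "continuous_map Y euclideanreal g" "g ` K \<subseteq> {0}" "g ` ?S \<subseteq> {1}"
        using Urysohn_completely_regular_compact_closed_alt[OF RY K pre[OF S]] by metis
      then show ?thesis
        using True p by (intro exI[of _ g] exI[of _ 0]) auto
    next
      case False
      then have xY: "x \<in> topspace Y" "x \<notin> K"
        using x unfolding ts f_def by (auto split: if_splits)
      then have "closedin Y (?S \<union> K)" "x \<in> topspace Y - (?S \<union> K)"
        using closedin_Un[OF pre[OF S] KY(2)] x by (simp_all add: f_def)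
      then obtain g where "continuous_map Y euclideanreal g" "g x = 0" "g ` (?S \<union> K) \<subseteq> {1}"
        using RY[unfolded completely_regular_space_alt, rule_format, of "?S \<union> K" x] by blast
      then show ?thesis
        by (intro exI[of _ g] exI[of _ 1]) auto
    qed
    then obtain g c where g: "continuous_map Y euclideanreal g" "g x = 0" "g ` ?S \<subseteq> {1}" "g ` K \<subseteq> {c}"
      by blast
    have gf: "g (f y) = g y" for y
      using g(4) p by (auto simp: f_def)
    have "continuous_map Z euclideanreal g"
      using continuous_compose_quotient_map[OF q, of euclideanreal g] g(1)
      by (simp add: o_def gf)
    moreover have "g ` S \<subseteq> {1}"
    proof
      fix t assume "t \<in> g ` S"
      then obtain s where "s \<in> S" "t = g s" by blast
      moreover from this have "s \<in> f ` topspace Y"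
        using closedin_subset[OF S] ts by auto
      ultimately show "t \<in> {1}"
        using g(3) gf by auto
    qed
    ultimately show "\<exists>f. continuous_map Z euclideanreal f \<and> f x = 0 \<and> f ` S \<subseteq> {1}"
      using g(2) by blast
  qed
  moreover have "t1_space Z"
    unfolding t1_space_closedin_singleton
  proof
    fix z assume z: "z \<in> topspace Z"
    then have "compactin Y {x \<in> topspace Y. f x = z}"
      using perf by (simp add: perfect_map_def proper_map_def)
    then show "closedin Z {z}"
      using z HY compactin_imp_closedin by (auto simp: clZ)
  qed
  ultimately have "tychonoff_space Z"
    unfolding tychonoff_space_def
    using completely_regular_imp_regular_space regular_t1_eq_Hausdorff_space by blast
  moreover have "p \<in> topspace Z"
    using p KY unfolding ts f_def by auto
  moreover have "closedin Y C \<and> C \<inter> K = {} \<and> subtopology Z C = subtopology Y C"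
    if C: "closedin Z C" "p \<notin> C" for C
  proof -
    \<comment> \<open>Off \<open>p\<close> the collapse is the identity, so subsets of
      \<open>C\<close> are their own preimages, and the two topologies agree on them.\<close>
    have eq: "{x \<in> topspace Y. f x \<in> D} = D" "D \<inter> K = {}" "D \<subseteq> topspace Z \<longleftrightarrow> D \<subseteq> topspace Y"
      if "D \<subseteq> C" for D
    proof -
      have "D \<subseteq> topspace Z" "p \<notin> D"
        using that C closedin_subset by auto
      then show "D \<inter> K = {}" "{x \<in> topspace Y. f x \<in> D} = D"
         "D \<subseteq> topspace Z \<longleftrightarrow> D \<subseteq> topspace Y"
        unfolding ts using fY by (auto simp: f_def split: if_splits)
    qed
    have cl: "closedin Z D \<longleftrightarrow> closedin Y D" if "D \<subseteq> C" for D
      unfolding clZ using eq[OF that] closedin_subset by metis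
    have CY: "closedin Y C" using cl C by blast
    have "subtopology Z C = subtopology Y C"
      unfolding topology_eq
    proof
      fix U
      have ts: "topspace (subtopology Z C) = C" "topspace (subtopology Y C) = C"
        using C CY closedin_subset by auto
      have "closedin (subtopology Z C) (C - U) \<longleftrightarrow> closedin (subtopology Y C) (C - U)"
        using cl C CY by (simp add: closedin_closed_subtopology)
      then show "openin (subtopology Z C) U \<longleftrightarrow> openin (subtopology Y C) U"
        unfolding openin_closedin_eq ts by blast
    qed
    then show ?thesis
      using CY eq(2)[of C] by auto
  qed
  ultimately show thesis
    using that perf by metis
qed

text \<open>After \<open>K\<close> is collapsed to \<open>p\<close>, the complements of open
  neighbourhoods of \<open>p\<close> are closed sets of \<open>Y\<close> missing \<open>K\<close>.
  Condition (W) gives \<open>P\<close> for the quotient, and inverse invariance lifts it to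
  \<open>Y\<close>.\<close>

lemma property_if_closed_disjoint:
  fixes P :: "'u topology \<Rightarrow> bool"
  assumes P: "perfect_inverse_invariant P" "mrowka_W P"
    and Y: "tychonoff_space Y" "compactin Y K"
    and C: "\<And>C. closedin Y C \<Longrightarrow> C \<inter> K = {} \<Longrightarrow> P (subtopology Y C)"
  shows "P Y"
proof (cases "K = {}")
  case True
  then show ?thesis
    using C[OF closedin_topspace] by simp
next
  case False
  then obtain p where "p \<in> K" by blast
  then obtain Z :: "'u topology" and f where Z: "tychonoff_space Z" "perfect_map Y Z f" "p \<in> topspace Z"
    "\<And>C. closedin Z C \<Longrightarrow> p \<notin> C \<Longrightarrow>
      closedin Y C \<and> C \<inter> K = {} \<and> subtopology Z C = subtopology Y C"
    using collapse_compact[OF Y] by metis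
  have "open_base_at Z p {B. openin Z B \<and> p \<in> B}"
    by (auto simp: open_base_at_def)
  moreover have "P (subtopology Z (topspace Z - B))" if "B \<in> {B. openin Z B \<and> p \<in> B}" for B
  proof -
    have "closedin Z (topspace Z - B)" "p \<notin> topspace Z - B"
      using that by auto
    from Z(4)[OF this] show ?thesis
      using C by metis
  qed
  ultimately have "P Z"
    using P(2) Z(1,3) unfolding mrowka_W_def by blast
  then show ?thesis
    using P(1) Y Z(2) unfolding perfect_inverse_invariant_def tychonoff_space_def by blast
qed

section \<open>Extensions with compact remainder\<close>

text \<open>A witness of \<open>Y \<le> Z\<close> between representatives; the map runs from the
  larger extension to the smaller one.\<close>

definition ext_map :: "'u topology \<Rightarrow> 'u topology \<Rightarrow> 'u topology \<Rightarrow> ('u \<Rightarrow> 'u) \<Rightarrow> bool" where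
  "ext_map X Z Y f \<longleftrightarrow> continuous_map Z Y f \<and> (\<forall>x\<in>topspace X. f x = x)"

lemma rep_E_D:
  assumes "Y \<in> rep_E X"
  shows "topspace X \<subseteq> topspace Y" "subtopology Y (topspace X) = X"
    "Y closure_of topspace X = topspace Y" "Hausdorff_space Y" "tychonoff_space Y"
    "compactin Y (topspace Y - topspace X)" "closedin Y (topspace Y - topspace X)"
  using assms by (auto simp: rep_E_def extension_of_def tychonoff_space_def compactin_imp_closedin)

lemma rep_E_closedin_Int:
  assumes "Y \<in> rep_E X" "closedin Y C"
  shows "closedin X (C \<inter> topspace X)"
  using assms rep_E_D(2) by (metis closedin_subtopology)

lemma rep_E_closedin:
  assumes "Y \<in> rep_E X" "closedin Y C" "C \<subseteq> topspace X"
  shows "closedin X C"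
  using rep_E_closedin_Int[OF assms(1,2)] assms(3) by (simp add: inf.absorb1)

lemma rep_E_subtopology:
  assumes "Y \<in> rep_E X" "C \<subseteq> topspace X"
  shows "subtopology Y C = subtopology X C"
  using rep_E_D(2)[OF assms(1)] assms(2) by (metis inf.absorb2 subtopology_subtopology)

lemma ext_map_id: "topspace Y \<subseteq> topspace Z \<Longrightarrow> subtopology Z (topspace Y) = Y \<Longrightarrow> ext_map X Y Z id"
  unfolding ext_map_def by (metis continuous_map_from_subtopology continuous_map_id id_apply)

lemma ext_map_compose:
  assumes "ext_map X Z Y f" "ext_map X Y W g"
  shows "ext_map X Z W (g \<circ> f)"
  using assms unfolding ext_map_def by (auto intro: continuous_map_compose)

lemma ext_map_unique:
  assumes Z: "Z \<in> rep_E X" and Y: "Hausdorff_space Y"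
    and f: "ext_map X Z Y f" and g: "ext_map X Z Y g" and z: "z \<in> topspace Z"
  shows "f z = g z"
  using forall_in_closure_of_eq[of z Z "topspace X" Y f g] assms rep_E_D(3)[OF Z]
  unfolding ext_map_def by auto

text \<open>If \<open>f z\<close> fell into \<open>X\<close>, then on \<open>X\<close> with
  \<open>z\<close> adjoined both \<open>f\<close> and the identity would be continuous maps into
  \<open>Z\<close> agreeing on the dense set \<open>X\<close>. That forces \<open>f z = z\<close>,
  although \<open>z\<close> is outside \<open>X\<close>.\<close>

lemma ext_map_remainder:
  assumes Z: "Z \<in> rep_E X" and Y: "Y \<in> rep_E X" and f: "ext_map X Z Y f"
    and z: "z \<in> topspace Z - topspace X"
  shows "f z \<in> topspace Y - topspace X"
proof -
  have "f z \<in> topspace Y"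
    using f z by (auto simp: ext_map_def continuous_map_def)
  moreover have "f z \<notin> topspace X"
  proof
    assume fz: "f z \<in> topspace X"
    let ?T = "insert z (topspace X)"
    let ?Z = "subtopology Z ?T"
    have "continuous_map ?Z Y f"
      using f by (simp add: ext_map_def continuous_map_from_subtopology)
    moreover have "f \<in> topspace ?Z \<rightarrow> topspace X"
      using f fz by (auto simp: ext_map_def)
    ultimately have "continuous_map ?Z X f"
      using rep_E_D(2)[OF Y] by (metis continuous_map_in_subtopology)
    then have "continuous_map ?Z Z f"
      using rep_E_D(2)[OF Z] by (metis continuous_map_into_fulltopology)
    moreover have "continuous_map ?Z Z id"
      by (simp add: continuous_map_from_subtopology)
    moreover have "z \<in> ?Z closure_of topspace X"
      using z rep_E_D(3)[OF Z] unfolding closure_of_subtopology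
      by (simp add: Int_absorb1 subset_insertI)
    ultimately have "f z = id z"
      using f forall_in_closure_of_eq[OF _ rep_E_D(4)[OF Z]] unfolding ext_map_def
      by (metis id_apply)
    then show False
      using fz z by simp
  qed
  ultimately show ?thesis by blast
qed

lemma ext_map_preimage:
  assumes Z: "Z \<in> rep_E X" and Y: "Y \<in> rep_E X" and f: "ext_map X Z Y f"
    and C: "C \<subseteq> topspace X"
  shows "{z \<in> topspace Z. f z \<in> C} = C"
  using ext_map_remainder[OF Z Y f] C f rep_E_D(1)[OF Z] by (fastforce simp: ext_map_def)

lemma rep_E_compact_subspace:
  assumes Y: "Y \<in> rep_E X" and K: "compactin Y K" "K \<subseteq> topspace Y - topspace X"
  shows "subtopology Y (topspace X \<union> K) \<in> rep_E X"
proof -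
  let ?S = "subtopology Y (topspace X \<union> K)"
  have ts: "topspace ?S = topspace X \<union> K"
    using K rep_E_D(1)[OF Y] by auto
  have "subtopology ?S (topspace X) = X"
    using rep_E_D(2)[OF Y] by (simp add: subtopology_subtopology Int_absorb1)
  moreover have "?S closure_of topspace X = topspace ?S"
    unfolding closure_of_subtopology ts using K rep_E_D(1,3)[OF Y] by (simp add: Int_absorb1) blast
  moreover have "tychonoff_space ?S"
    using rep_E_D(5)[OF Y] 
    by (simp add: tychonoff_space_def completely_regular_space_subtopology Hausdorff_space_subtopology)
  moreover have "topspace ?S - topspace X = K"
    unfolding ts using K by auto
  ultimately show ?thesis
    using K rep_E_D(1)[OF Y] unfolding rep_E_def extension_of_def
    by (simp add: compactin_subtopology)
qed

lemma continuous_map_id_finer: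
  assumes "topspace Z = topspace Y" "\<And>U. openin Y U \<Longrightarrow> openin Z U"
  shows "continuous_map Z Y id"
proof -
  have "{x \<in> topspace Z. id x \<in> U} = U" if "openin Y U" for U
    using openin_subset[OF that] assms(1) by auto
  then show ?thesis
    using assms by (simp add: continuous_map_def)
qed

text \<open>A compact topology cannot be strictly finer than a Hausdorff one, so refining an
  extension leaves its remainder unchanged.\<close>

lemma rep_E_finer_remainder:
  assumes Y: "Y \<in> rep_E X" and Z: "Z \<in> rep_E X" and ts: "topspace Z = topspace Y"
    and fin: "\<And>U. openin Y U \<Longrightarrow> openin Z U"
  shows "subtopology Z (topspace Y - topspace X) = subtopology Y (topspace Y - topspace X)"
proof (rule compact_Hausdorff_space_optimal)
  show "Hausdorff_space (subtopology Y (topspace Y - topspace X))"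
    using rep_E_D(4)[OF Y] by (rule Hausdorff_space_subtopology)
  show "compact_space (subtopology Z (topspace Y - topspace X))"
    using rep_E_D(6)[OF Z] ts by (simp add: compact_space_subtopology)
  show "openin (subtopology Z (topspace Y - topspace X)) U"
    if "openin (subtopology Y (topspace Y - topspace X)) U" for U
    using that fin by (auto simp: openin_subtopology)
qed (simp add: ts)

section \<open>The ideal of closed subsets with P, and minimality\<close>

text \<open>Collects what the later arguments need to know about \<open>P\<close>: its closed sets
  in \<open>X\<close> form an ideal, and an extension has \<open>P\<close> exactly when its closed
  sets inside \<open>X\<close> belong to that ideal.\<close>

locale closed_ideal =
  fixes P :: "'u topology \<Rightarrow> bool" and X :: "'u topology"
  assumes P_iff: "Y \<in> rep_E X \<Longrightarrow>
      P Y \<longleftrightarrow> (\<forall>C. closedin Y C \<longrightarrow> C \<subseteq> topspace X \<longrightarrow> P (subtopology X C))"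
    and mono: "closedin X C \<Longrightarrow> closedin X D \<Longrightarrow> C \<subseteq> D \<Longrightarrow> P (subtopology X D) \<Longrightarrow> P (subtopology X C)"
    and union: "closedin X C \<Longrightarrow> closedin X D \<Longrightarrow> P (subtopology X C) \<Longrightarrow> P (subtopology X D)
      \<Longrightarrow> P (subtopology X (C \<union> D))"
begin

abbreviation "\<F> C \<equiv> P (subtopology X C)"

abbreviation "EP \<equiv> rep_E_prop P X"

lemma EP_iff:
  "Y \<in> EP \<longleftrightarrow> Y \<in> rep_E X \<and> (\<forall>C. closedin Y C \<longrightarrow> C \<subseteq> topspace X \<longrightarrow> \<F> C)"
  using P_iff by (auto simp: rep_E_prop_def)

text \<open>Remainders go to remainders, so a closed set of \<open>Y\<close> inside \<open>X\<close>
  is its own preimage and is closed in \<open>Z\<close>. Thus \<open>Y\<close> imposes no condition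
  that \<open>Z\<close> does not.\<close>

lemma EP_ext_map:
  assumes Z: "Z \<in> EP" and Y: "Y \<in> rep_E X" and f: "ext_map X Z Y f"
  shows "Y \<in> EP"
  unfolding EP_iff
proof (intro conjI allI impI Y)
  fix C assume C: "closedin Y C" "C \<subseteq> topspace X"
  have "closedin Z {z \<in> topspace Z. f z \<in> C}"
    using f C(1) unfolding ext_map_def by (blast intro: closedin_continuous_map_preimage)
  then show "\<F> C"
    using Z C(2) ext_map_preimage[OF _ Y f C(2)] by (auto simp: EP_iff)
qed

text \<open>A subextension is determined by its remainder, a compact part of the given one, so
  minimality only has to be tested on compact sets \<open>K\<close>.\<close>

lemma rep_M_iff:
  "Y \<in> rep_M P X \<longleftrightarrow> Y \<in> EP \<and>
     (\<forall>K. compactin Y K \<longrightarrow> K \<subset> topspace Y - topspace X \<longrightarrow> subtopology Y (topspace X \<union> K) \<notin> EP)"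
proof (intro iffI conjI allI impI notI)
  assume Y: "Y \<in> rep_M P X"
  then show "Y \<in> EP" by (simp add: rep_M_def)
  fix K assume K: "compactin Y K" "K \<subset> topspace Y - topspace X"
    and S: "subtopology Y (topspace X \<union> K) \<in> EP"
  let ?S = "subtopology Y (topspace X \<union> K)"
  have "topspace X \<subseteq> topspace Y"
    using \<open>Y \<in> EP\<close> rep_E_D(1) by (auto simp: EP_iff)
  then have ts: "topspace ?S = topspace X \<union> K" and "topspace ?S \<subset> topspace Y"
    using K by auto
  moreover have "subtopology Y (topspace ?S) = ?S"
    by (simp only: ts)
  ultimately show False
    using Y S unfolding rep_M_def by blast
next
  assume Y: "Y \<in> EP \<and>
     (\<forall>K. compactin Y K \<longrightarrow> K \<subset> topspace Y - topspace X \<longrightarrow> subtopology Y (topspace X \<union> K) \<notin> EP)"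
  have False if Z: "Z \<in> EP" "topspace Z \<subset> topspace Y" "subtopology Y (topspace Z) = Z" for Z
  proof -
    let ?K = "topspace Z - topspace X"
    have "Z \<in> rep_E X" using Z by (simp add: EP_iff)
    note * = rep_E_D(1,6)[OF this]
    have "compactin Y ?K"
      using *(2) Z(3) by (metis compactin_subtopology)
    moreover have "?K \<subset> topspace Y - topspace X" "topspace X \<union> ?K = topspace Z"
      using Z(2) * by auto
    ultimately show False
      using Y Z by metis
  qed
  then show "Y \<in> rep_M P X"
    using Y by (auto simp: rep_M_def)
qed

text \<open>The image consists of \<open>X\<close> and a compact part of the remainder. It lies
  below \<open>Z\<close> and so has \<open>P\<close>; minimality of \<open>Y\<close> makes it
  everything.\<close>

lemma rep_M_ext_map_surj:
  assumes Y: "Y \<in> rep_M P X" and Z: "Z \<in> EP" and f: "ext_map X Z Y f"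
  shows "f ` topspace Z = topspace Y"
proof -
  have YE: "Y \<in> rep_E X" and ZE: "Z \<in> rep_E X"
    using Y Z by (auto simp: rep_M_iff EP_iff)
  let ?K = "f ` (topspace Z - topspace X)"
  have K: "compactin Y ?K" "?K \<subseteq> topspace Y - topspace X"
    using f rep_E_D(6)[OF ZE] image_compactin ext_map_remainder[OF ZE YE f] 
    by (auto simp: ext_map_def)
  have "f ` topspace Z = f ` topspace X \<union> ?K"
    using rep_E_D(1)[OF ZE] by auto
  also have "f ` topspace X = topspace X"
    using f by (simp add: ext_map_def)
  finally have im: "f ` topspace Z = topspace X \<union> ?K" .
  then have "ext_map X Z (subtopology Y (topspace X \<union> ?K)) f"
    using f unfolding ext_map_def continuous_map_in_subtopology by blast
  then have "subtopology Y (topspace X \<union> ?K) \<in> EP"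
    using EP_ext_map[OF Z rep_E_compact_subspace[OF YE K]] by blast
  then have "?K = topspace Y - topspace X"
    using Y K unfolding rep_M_iff by blast
  then show ?thesis
    using im rep_E_D(1)[OF YE] by auto
qed

text \<open>Maps to \<open>Y\<close> are unique, so a map from any \<open>T\<close> above
  \<open>Z\<close> has its image inside the proper subspace \<open>Z\<close>. All such
  \<open>T\<close> are covered because a cofinal family need not contain \<open>Z\<close>
  itself.\<close>

lemma not_rep_M_proper_subspace:
  assumes Y: "Y \<in> EP" "Y \<notin> rep_M P X"
  obtains Z where "Z \<in> EP" "ext_map X Z Y id"
    "\<And>T f. T \<in> EP \<Longrightarrow> ext_map X T Z f \<Longrightarrow> \<not> (\<exists>g. ext_map X T Y g \<and> g ` topspace T = topspace Y)"
proof -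
  obtain Z where Z: "Z \<in> EP" "topspace Z \<subset> topspace Y" "subtopology Y (topspace Z) = Z"
    using Y by (auto simp: rep_M_def)
  then have id: "ext_map X Z Y id"
    by (simp add: ext_map_id)
  have "\<not> (\<exists>g. ext_map X T Y g \<and> g ` topspace T = topspace Y)"
    if T: "T \<in> EP" "ext_map X T Z f" for T f
  proof
    assume "\<exists>g. ext_map X T Y g \<and> g ` topspace T = topspace Y"
    then obtain g where g: "ext_map X T Y g" "g ` topspace T = topspace Y" by blast
    have "T \<in> rep_E X" "Hausdorff_space Y"
      using T Y rep_E_D(4) by (auto simp: EP_iff)
    then have "g t = f t" if "t \<in> topspace T" for t
      using ext_map_unique[OF _ _ g(1) ext_map_compose[OF T(2) id] that] by simp
    then have "g ` topspace T = f ` topspace T" by auto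
    then have "g ` topspace T \<subseteq> topspace Z"
      using T(2) by (auto simp: ext_map_def continuous_map_def)
    then show False using g(2) Z(2) by auto
  qed
  then show thesis using that Z id by blast
qed

section \<open>Minimal subextensions\<close>

text \<open>Zorn's lemma is applied to the sets of remainder points whose removal preserves
  \<open>P\<close>; removing a maximal one leaves a minimal subextension.\<close>

lemma ex_rep_M:
  assumes Y: "Y \<in> EP"
  obtains Z where "Z \<in> rep_M P X" "ext_map X Z Y id"
proof -
  have YE: "Y \<in> rep_E X" using Y by (simp add: EP_iff)
  let ?R = "topspace Y - topspace X"
  let ?S = "\<lambda>U. subtopology Y (topspace X \<union> (?R - U))"
  \<comment> \<open>Recording the removed points instead of the remaining ones turns upper bounds of
    chains into unions.\<close>
  define \<A> where "\<A> = {U. U \<subseteq> ?R \<and> compactin Y (?R - U) \<and> ?S U \<in> EP}"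
  note XY = rep_E_D(1)[OF YE]
  have "?S {} = Y"
    using XY by (simp add: Un_absorb1)
  then have "{} \<in> \<A>"
    using Y rep_E_D(6)[OF YE] by (simp add: \<A>_def)
  have "\<exists>M\<in>\<A>. \<forall>U\<in>\<A>. M \<subseteq> U \<longrightarrow> U = M"
  proof (rule subset_Zorn_nonempty)
    show "\<A> \<noteq> {}" using \<open>{} \<in> \<A>\<close> by blast
    fix \<C> assume ne: "\<C> \<noteq> {}" and ch: "subset.chain \<A> \<C>"
    then have CA: "U \<in> \<A>" if "U \<in> \<C>" for U
      using that by (auto simp: subset.chain_def)
    have cl: "closedin Y (?R - U)" if "U \<in> \<C>" for U
      using CA[OF that] rep_E_D(4)[OF YE] by (auto simp: \<A>_def compactin_imp_closedin)
    have "?R - \<Union>\<C> = \<Inter>((\<lambda>U. ?R - U) ` \<C>)"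
      using ne by auto
    moreover have "closedin Y (\<Inter>((\<lambda>U. ?R - U) ` \<C>))"
      using cl ne by (intro closedin_Inter) auto
    ultimately have K: "compactin Y (?R - \<Union>\<C>)"
      using closed_compactin[OF rep_E_D(6)[OF YE]] by (metis Diff_subset)
    have "\<F> D" if D: "closedin (?S (\<Union>\<C>)) D" "D \<subseteq> topspace X" for D
    proof -
      obtain V where V: "closedin Y V" "D = V \<inter> (topspace X \<union> (?R - \<Union>\<C>))"
        using D(1) by (auto simp: closedin_subtopology)
      have VR: "V \<inter> ?R \<subseteq> \<Union>\<C>" and VX: "D = V \<inter> topspace X"
        using V D(2) by auto
      have "compactin Y (V \<inter> ?R)"
        using closed_Int_compactin[OF V(1) rep_E_D(6)[OF YE]] .
      \<comment> \<open>A removed set \<open>U\<close> need not be open in \<open>Y\<close>, but the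
        complement of \<open>?R - U\<close> is, and it meets \<open>?R\<close> exactly in
        \<open>U\<close>. These sets cover the compact set \<open>V \<inter> ?R\<close>, so by the
        chain property a single \<open>U\<close> contains it.\<close>
      moreover have "\<And>U. U \<in> (\<lambda>U. topspace Y - (?R - U)) ` \<C> \<Longrightarrow> openin Y U"
        using cl by auto
      moreover have "V \<inter> ?R \<subseteq> \<Union>((\<lambda>U. topspace Y - (?R - U)) ` \<C>)"
        using VR by auto
      ultimately obtain \<G> where "finite \<G>" "\<G> \<subseteq> (\<lambda>U. topspace Y - (?R - U)) ` \<C>" "V \<inter> ?R \<subseteq> \<Union>\<G>"
        using compactinD by meson
      then obtain \<C>' where C': "finite \<C>'" "\<C>' \<subseteq> \<C>" "\<G> = (\<lambda>U. topspace Y - (?R - U)) ` \<C>'"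
        by (metis finite_subset_image)
      then have "V \<inter> ?R \<subseteq> \<Union>\<C>'"
        using \<open>V \<inter> ?R \<subseteq> \<Union>\<G>\<close> by blast
      have "\<exists>U\<in>\<C>. V \<inter> ?R \<subseteq> U"
      proof (cases "\<C>' = {}")
        case True
        then show ?thesis using \<open>V \<inter> ?R \<subseteq> \<Union>\<C>'\<close> ne by blast
      next
        case False
        have "subset.chain \<A> \<C>'"
          using ch C'(2) unfolding subset.chain_def by blast
        then have "\<Union>\<C>' \<in> \<C>'"
          using Union_in_chain C'(1) False by blast
        then show ?thesis using \<open>V \<inter> ?R \<subseteq> \<Union>\<C>'\<close> C'(2) by blast
      qed
      then obtain U where U: "U \<in> \<C>" "V \<inter> ?R \<subseteq> U" by blast
      have "D = V \<inter> (topspace X \<union> (?R - U))"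
        using VX U by auto
      then have "closedin (?S U) D"
        using V(1) closedin_subtopology by blast
      then show ?thesis
        using CA[OF U(1)] D(2) by (simp add: \<A>_def EP_iff)
    qed
    then have "?S (\<Union>\<C>) \<in> EP"
      using rep_E_compact_subspace[OF YE K] by (simp add: EP_iff)
    then show "\<Union>\<C> \<in> \<A>"
      using K CA by (auto simp: \<A>_def)
  qed
  then obtain M where M: "M \<in> \<A>" and max: "\<And>U. U \<in> \<A> \<Longrightarrow> M \<subseteq> U \<Longrightarrow> U = M"
    by blast
  have ts: "topspace (?S M) = topspace X \<union> (?R - M)"
    using XY by auto
  have "?S M \<in> rep_M P X"
    unfolding rep_M_iff
  proof (intro conjI allI impI notI)
    show "?S M \<in> EP" using M by (simp add: \<A>_def)
    fix K assume K: "compactin (?S M) K" "K \<subset> topspace (?S M) - topspace X"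
      and E: "subtopology (?S M) (topspace X \<union> K) \<in> EP"
    have KR: "K \<subset> ?R - M" using K(2) unfolding ts by auto
    then have eq: "?R - (?R - K) = K" by auto
    have "subtopology (?S M) (topspace X \<union> K) = subtopology Y (topspace X \<union> K)"
      unfolding subtopology_subtopology using KR
      by (metis Un_mono inf.absorb2 psubset_imp_subset subset_refl)
    then have "?R - K \<in> \<A>"
      using E K(1) by (auto simp: \<A>_def eq compactin_subtopology)
    moreover have "M \<subseteq> ?R - K" "?R - K \<noteq> M"
      using KR M by (auto simp: \<A>_def)
    ultimately show False using max by blast
  qed
  moreover have "ext_map X (?S M) Y id"
    by (auto simp: ext_map_def continuous_map_from_subtopology)
  ultimately show thesis using that by blast
qed

text \<open>If a remainder point \<open>s\<close> of \<open>Y\<close> can be dropped, it has a closed neighbourhood \<open>N\<close> with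
  \<open>N \<inter> X\<close> in the ideal; the preimage of its interior can then be dropped from \<open>Z\<close>.\<close>
lemma rep_M_surj_image:
  assumes Z: "Z \<in> rep_M P X" and Y: "Y \<in> rep_E X" and f: "ext_map X Z Y f"
    and surj: "f ` topspace Z = topspace Y"
  shows "Y \<in> rep_M P X"
proof (rule ccontr)
  assume nM: "Y \<notin> rep_M P X"
  have ZE: "Z \<in> EP" "Z \<in> rep_E X" using Z by (auto simp: rep_M_iff EP_iff)
  have YE: "Y \<in> EP" using EP_ext_map[OF ZE(1) Y f] .
  obtain K where K: "compactin Y K" "K \<subset> topspace Y - topspace X"
    "subtopology Y (topspace X \<union> K) \<in> EP"
    using nM YE unfolding rep_M_iff by blast
  then obtain s where s: "s \<in> topspace Y - topspace X" "s \<notin> K" by blast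
  have "closedin Y K"
    using K rep_E_D(4)[OF Y] compactin_imp_closedin by blast
  moreover have "regular_space Y"
    using rep_E_D(5)[OF Y] completely_regular_imp_regular_space by (auto simp: tychonoff_space_def)
  moreover have "s \<in> topspace Y - K"
    using s by blast
  ultimately have "\<exists>U V. openin Y U \<and> openin Y V \<and> s \<in> U \<and> K \<subseteq> V \<and> disjnt U V"
    by (simp add: regular_space_def)
  then obtain U V where UV: "openin Y U" "openin Y V" "s \<in> U" "K \<subseteq> V" "disjnt U V"
    by blast
  define N where "N = topspace Y - V"
  have N: "closedin Y N" "U \<subseteq> N" "N \<inter> K = {}"
    using UV openin_subset[OF UV(1)] unfolding N_def disjnt_def by auto
  \<comment> \<open>As \<open>N\<close> misses \<open>K\<close>, its trace on \<open>X\<close> is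
    closed in the subextension with remainder \<open>K\<close>, which has \<open>P\<close>.\<close>
  have "N \<inter> topspace X = N \<inter> (topspace X \<union> K)"
    using N(3) by auto
  then have "closedin (subtopology Y (topspace X \<union> K)) (N \<inter> topspace X)"
    using N(1) closedin_subtopology by blast
  then have FN: "\<F> (N \<inter> topspace X)"
    using K(3) by (simp add: EP_iff)
  have clN: "closedin X (N \<inter> topspace X)"
    using rep_E_closedin_Int[OF Y N(1)] .
  define W where "W = {z \<in> topspace Z. f z \<in> U}"
  have W: "openin Z W"
    using f UV(1) unfolding W_def ext_map_def by (blast intro: openin_continuous_map_preimage)
  define L where "L = (topspace Z - topspace X) - W"
  have "L = (topspace Z - topspace X) \<inter> (topspace Z - W)"
    by (auto simp: L_def)
  then have L: "compactin Z L"
    using compact_Int_closedin[OF rep_E_D(6)[OF ZE(2)]] W by auto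
  \<comment> \<open>Surjectivity enters here: a point over \<open>s\<close> is a remainder point in
    \<open>W\<close>, so \<open>L\<close> is a proper part of the remainder.\<close>
  obtain z where z: "z \<in> topspace Z" "f z = s"
    using s surj by (metis DiffD1 imageE)
  then have "z \<notin> topspace X"
    using f s by (auto simp: ext_map_def)
  then have LR: "L \<subset> topspace Z - topspace X"
    using z UV(3) by (auto simp: L_def W_def)
  have "\<F> D" if D: "closedin (subtopology Z (topspace X \<union> L)) D" "D \<subseteq> topspace X" for D
  proof -
    obtain T where T: "closedin Z T" "D = T \<inter> (topspace X \<union> L)"
      using D(1) by (auto simp: closedin_subtopology)
    have DX: "D = T \<inter> topspace X" and TL: "T \<inter> L = {}"
      using T D(2) LR by auto
    then have clD: "closedin X D"
      using rep_E_closedin_Int[OF ZE(2) T(1)] by simp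
    \<comment> \<open>All remainder points of \<open>T\<close> lie in \<open>W\<close>, so cutting
      off the open set \<open>W\<close> leaves a closed set of \<open>Z\<close> inside
      \<open>X\<close>. What was cut off from \<open>D\<close> lies in \<open>N\<close>, since
      \<open>f\<close> is the identity on \<open>X\<close>.\<close>
    have "T - W \<subseteq> topspace X"
      using closedin_subset[OF T(1)] TL by (auto simp: L_def)
    moreover have clTW: "closedin Z (T - W)"
      using T(1) W by (simp add: closedin_diff)
    ultimately have "\<F> (T - W)"
      using ZE(1) by (simp add: EP_iff)
    have clTWX: "closedin X (T - W)"
      using rep_E_closedin[OF ZE(2) clTW] \<open>T - W \<subseteq> topspace X\<close> by simp
    have "D \<subseteq> (T - W) \<union> (N \<inter> topspace X)"
    proof
      fix d assume d: "d \<in> D"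
      show "d \<in> (T - W) \<union> (N \<inter> topspace X)"
      proof (cases "d \<in> W")
        case True
        then have "d \<in> U"
          using d DX f by (auto simp: W_def ext_map_def)
        then show ?thesis using N(2) d DX by auto
      next
        case False
        then show ?thesis using d DX by auto
      qed
    qed
    then show ?thesis
      using mono[OF clD closedin_Un[OF clTWX clN]] union[OF clTWX clN \<open>\<F> (T - W)\<close> FN] by blast
  qed
  then have "subtopology Z (topspace X \<union> L) \<in> EP"
    using rep_E_compact_subspace[OF ZE(2) L] LR by (simp add: EP_iff)
  then show False
    using Z L LR unfolding rep_M_iff by blast
qed

section \<open>Optimal refinements\<close>

text \<open>A set compact in the finer topology is compact in the coarser one. The identity then
  carries a proper subextension of \<open>Z\<close> with \<open>P\<close> down to one of
  \<open>Y\<close>, against minimality.\<close>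

lemma rep_M_finer:
  assumes Y: "Y \<in> rep_M P X" and Z: "Z \<in> EP" and ts: "topspace Z = topspace Y"
    and fin: "\<And>U. openin Y U \<Longrightarrow> openin Z U"
  shows "Z \<in> rep_M P X"
  unfolding rep_M_iff
proof (intro conjI allI impI notI Z)
  fix K assume K: "compactin Z K" "K \<subset> topspace Z - topspace X"
    and S: "subtopology Z (topspace X \<union> K) \<in> EP"
  have id: "continuous_map Z Y id"
    using continuous_map_id_finer[OF ts fin] .
  have YE: "Y \<in> rep_E X" using Y by (simp add: rep_M_iff EP_iff)
  have KY: "compactin Y K"
    using image_compactin[OF K(1) id] by simp
  have "ext_map X (subtopology Z (topspace X \<union> K)) (subtopology Y (topspace X \<union> K)) id"
    using id by (auto simp: ext_map_def continuous_map_in_subtopology continuous_map_from_subtopology)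
  then have "subtopology Y (topspace X \<union> K) \<in> EP"
    using EP_ext_map[OF S] rep_E_compact_subspace[OF YE KY] K(2) ts by auto
  then show False
    using Y KY K(2) ts unfolding rep_M_iff by auto
qed

text \<open>The chain step for maximal topologies. A topology is represented by its family of open
  sets, so that inclusion means refinement. The union of a chain is closed under binary
  intersections and serves as a base of the join.\<close>

lemma EP_chain_join:
  assumes Y: "Y \<in> EP" and ne: "\<C> \<noteq> {}"
    and ch: "subset.chain {Collect (openin Z) |Z.
      Z \<in> EP \<and> topspace Z = topspace Y \<and> (\<forall>U. openin Y U \<longrightarrow> openin Z U)} \<C>"
  obtains J where "J \<in> EP" "topspace J = topspace Y" "\<forall>U\<in>\<Union>\<C>. openin J U"
proof -
  let ?R = "topspace Y - topspace X"
  have YE: "Y \<in> rep_E X" using Y by (simp add: EP_iff)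
  note XY = rep_E_D(1)[OF YE]
  have C: "\<exists>Z. c = Collect (openin Z) \<and> Z \<in> EP \<and> topspace Z = topspace Y \<and>
      (\<forall>U. openin Y U \<longrightarrow> openin Z U)" if "c \<in> \<C>" for c
    using ch that unfolding subset.chain_def by blast
  have B: "\<exists>Z. Collect (openin Z) \<in> \<C> \<and> openin Z V \<and> Z \<in> EP \<and> Z \<in> rep_E X \<and>
      topspace Z = topspace Y" if "V \<in> \<Union>\<C>" for V
    using that C by (metis EP_iff UnionE mem_Collect_eq)
  have YB: "U \<in> \<Union>\<C>" if "openin Y U" for U
    using that C ne by blast
  define J where "J = topology (arbitrary union_of (\<lambda>U. U \<in> \<Union>\<C>))"
  have "istopology (arbitrary union_of (\<lambda>U. U \<in> \<Union>\<C>))"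
  proof (rule istopology_base)
    fix S T assume "S \<in> \<Union>\<C>" "T \<in> \<Union>\<C>"
    then have "{S, T} \<subseteq> \<Union>\<C>" by blast
    then obtain c where "c \<in> \<C>" "{S, T} \<subseteq> c"
      using finite_subset_Union_chain[OF _ _ ne ch, of "{S, T}"] by blast
    then have "c \<in> \<C>" "S \<in> c" "T \<in> c" by auto
    moreover from this obtain Z where "c = Collect (openin Z)" using C by blast
    ultimately show "S \<inter> T \<in> \<Union>\<C>" by blast
  qed
  then have J: "openin J = arbitrary union_of (\<lambda>U. U \<in> \<Union>\<C>)"
    by (simp add: J_def)
  note JB = J[unfolded openin_topology_base_unique]
  have BJ: "openin J V" if "V \<in> \<Union>\<C>" for V
    using that JB by simp
  \<comment> \<open>Each point of an open set of the join has a basic neighbourhood that is open in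
    a single member of the chain; density and complete regularity are read off in that
    member.\<close>
  have base: thesis
    if "openin J U" "x \<in> U" and "\<And>V Z. V \<in> \<Union>\<C> \<Longrightarrow> x \<in> V \<Longrightarrow> V \<subseteq> U \<Longrightarrow> openin Z V \<Longrightarrow>
      Z \<in> rep_E X \<Longrightarrow> topspace Z = topspace Y \<Longrightarrow> Collect (openin Z) \<in> \<C> \<Longrightarrow> thesis"
    for U x thesis
  proof -
    obtain V where V: "V \<in> \<Union>\<C>" "x \<in> V" "V \<subseteq> U"
      using JB \<open>openin J U\<close> \<open>x \<in> U\<close> by meson
    from B[OF V(1)] that(3)[OF V] show ?thesis
      by metis
  qed
  have finer: "openin J U" if "openin Y U" for U
    using that YB BJ by blast
  have ZJ: "openin J U" if "Collect (openin Z) \<in> \<C>" "openin Z U" for Z U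
    using that BJ by blast
  have ts: "topspace J = topspace Y"
  proof
    show "topspace J \<subseteq> topspace Y"
    proof
      fix x assume "x \<in> topspace J"
      from base[OF openin_topspace this] show "x \<in> topspace Y"
        using openin_subset by (metis subsetD)
    qed
    show "topspace Y \<subseteq> topspace J"
      using finer openin_subset by blast
  qed
  have id: "continuous_map J Z id" if "Collect (openin Z) \<in> \<C>" "topspace Z = topspace Y" for Z
    using continuous_map_id_finer[of J Z] that ts ZJ by simp
  \<comment> \<open>Applied to \<open>X\<close> and to the remainder: on both, all members of the
    chain induce the same topology as \<open>Y\<close>.\<close>
  have sub: "subtopology J S = subtopology Y S"
    if S: "S \<subseteq> topspace Y" and eq: "\<And>Z. Z \<in> rep_E X \<Longrightarrow> topspace Z = topspace Y \<Longrightarrow>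
      Collect (openin Z) \<in> \<C> \<Longrightarrow> subtopology Z S = subtopology Y S" for S
    unfolding topology_eq
  proof (intro allI iffI)
    fix U assume "openin (subtopology Y S) U"
    then show "openin (subtopology J S) U"
      using finer by (auto simp: openin_subtopology)
  next
    fix U assume "openin (subtopology J S) U"
    then obtain V where V: "openin J V" "U = V \<inter> S"
      by (auto simp: openin_subtopology)
    have "\<exists>T. openin (subtopology Y S) T \<and> x \<in> T \<and> T \<subseteq> U" if "x \<in> U" for x
    proof -
      have "x \<in> V" using that V(2) by simp
      obtain W Z where "W \<in> \<Union>\<C>" and W: "x \<in> W" "W \<subseteq> V" "openin Z W" "Z \<in> rep_E X"
          "topspace Z = topspace Y" "Collect (openin Z) \<in> \<C>"
        by (rule base[OF V(1) \<open>x \<in> V\<close>])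
      then have "openin (subtopology Y S) (W \<inter> S)"
        using eq[OF W(4-6)] by (metis openin_subtopology)
      then show ?thesis
        using W that V(2) by blast
    qed
    then show "openin (subtopology Y S) U"
      using openin_subopen by metis
  qed
  have "subtopology J (topspace X) = X"
    using sub[OF XY] rep_E_D(2) YE by metis
  moreover have "J closure_of topspace X = topspace J"
  proof
    show "topspace J \<subseteq> J closure_of topspace X"
    proof
      fix x assume x: "x \<in> topspace J"
      have "\<exists>y. y \<in> topspace X \<and> y \<in> T" if T: "x \<in> T" "openin J T" for T
      proof -
        obtain V Z where "V \<in> \<Union>\<C>" and V: "x \<in> V" "V \<subseteq> T" "openin Z V" "Z \<in> rep_E X"
            "topspace Z = topspace Y" "Collect (openin Z) \<in> \<C>"
          by (rule base[OF T(2,1)])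
        then have "x \<in> Z closure_of topspace X"
          using rep_E_D(3) x ts by metis
        then have "\<exists>y. y \<in> topspace X \<and> y \<in> V"
          using V(1,3) unfolding in_closure_of by blast
        then show ?thesis
          using V(2) by blast
      qed
      then show "x \<in> J closure_of topspace X"
        using x unfolding in_closure_of by blast
    qed
  qed (rule closure_of_subset_topspace)
  moreover have "Hausdorff_space J"
  proof (rule Hausdorff_space_injective_preimage[OF rep_E_D(4)[OF YE]])
    show "continuous_map J Y id"
      using continuous_map_id_finer[OF ts finer] .
  qed simp
  moreover have "completely_regular_space J"
    unfolding completely_regular_space_alt'
  proof (intro allI impI)
    fix S x assume S: "openin J S" "x \<in> S"
    obtain V Z where "V \<in> \<Union>\<C>" and V: "x \<in> V" "V \<subseteq> S" "openin Z V" "Z \<in> rep_E X"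
        "topspace Z = topspace Y" "Collect (openin Z) \<in> \<C>"
      by (rule base[OF S])
    then have "completely_regular_space Z"
      using rep_E_D(5) by (auto simp: tychonoff_space_def)
    then obtain f where f: "continuous_map Z euclideanreal f" "f x = 0" "f ` (topspace Z - V) \<subseteq> {1}"
      using V(1,3) unfolding completely_regular_space_alt' by blast
    then have "continuous_map J euclideanreal f"
      using continuous_map_compose[OF id[OF V(6,5)] f(1)] by simp
    then show "\<exists>f. continuous_map J euclideanreal f \<and> f x = 0 \<and> f ` (topspace J - S) \<subseteq> {1}"
      using f V(2,5) ts by blast
  qed
  moreover have KJ: "compactin J ?R"
  proof -
    have "subtopology Z ?R = subtopology Y ?R"
      if "Z \<in> rep_E X" "topspace Z = topspace Y" "Collect (openin Z) \<in> \<C>" for Z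
    proof (rule rep_E_finer_remainder[OF YE that(1,2)])
      show "openin Z U" if "openin Y U" for U
        using C[OF \<open>Collect (openin Z) \<in> \<C>\<close>] that by blast
    qed
    then have "subtopology J ?R = subtopology Y ?R"
      using sub by blast
    then show ?thesis
      using rep_E_D(6)[OF YE] ts by (simp add: compactin_subspace)
  qed
  ultimately have JE: "J \<in> rep_E X"
    using XY ts by (simp add: rep_E_def extension_of_def tychonoff_space_def)
  have "\<F> D" if D: "closedin J D" "D \<subseteq> topspace X" for D
  proof -
    \<comment> \<open>Finitely many basic sets missing \<open>D\<close> cover the compact remainder,
      and one member of the chain contains them all. In that member the complement of their union is
      a closed subset of \<open>X\<close>, hence in the ideal, and it contains
      \<open>D\<close>.\<close>
    let ?\<U> = "{V \<in> \<Union>\<C>. V \<inter> D = {}}"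
    have "?R \<subseteq> \<Union>?\<U>"
    proof
      fix x assume x: "x \<in> ?R"
      have "openin J (topspace J - D)"
        using D(1) by blast
      moreover have "x \<in> topspace J - D"
        using D(2) x unfolding ts by blast
      ultimately obtain V Z where "V \<in> \<Union>\<C>" "x \<in> V" "V \<subseteq> topspace J - D" "openin Z V" "Z \<in> rep_E X"
          "topspace Z = topspace Y" "Collect (openin Z) \<in> \<C>"
        by (rule base)
      then show "x \<in> \<Union>?\<U>"
        by blast
    qed
    moreover have "openin J V" if "V \<in> ?\<U>" for V
      using BJ that by simp
    ultimately have "\<exists>\<G>. finite \<G> \<and> \<G> \<subseteq> ?\<U> \<and> ?R \<subseteq> \<Union>\<G>"
      by (intro compactinD[OF KJ])
    then obtain \<G> where G: "finite \<G>" "\<G> \<subseteq> ?\<U>" "?R \<subseteq> \<Union>\<G>"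
      by metis
    have "\<G> \<subseteq> \<Union>\<C>"
      using G(2) by blast
    then obtain c where "c \<in> \<C>" "\<G> \<subseteq> c"
      by (rule finite_subset_Union_chain[OF G(1) _ ne ch])
    then obtain Z where Z: "Z \<in> EP" "topspace Z = topspace Y" "\<And>V. V \<in> \<G> \<Longrightarrow> openin Z V"
      using C[OF \<open>c \<in> \<C>\<close>] by blast
    then have "closedin Z (topspace Z - \<Union>\<G>)"
      by blast
    moreover have "topspace Z - \<Union>\<G> \<subseteq> topspace X"
      using G(3) Z(2) by blast
    ultimately have "\<F> (topspace Z - \<Union>\<G>)" "closedin X (topspace Z - \<Union>\<G>)"
      using Z(1) rep_E_closedin by (auto simp: EP_iff)
    moreover have "D \<subseteq> topspace Z - \<Union>\<G>"
      using G(2) D(2) XY Z(2) by blast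
    ultimately show ?thesis
      using mono rep_E_closedin[OF JE D] by blast
  qed
  then have "J \<in> EP"
    using JE by (simp add: EP_iff)
  then show thesis
    using that ts BJ by blast
qed

text \<open>Zorn's lemma gives a maximal topology with \<open>P\<close> above that of
  \<open>Y\<close>; by \<open>rep_M_finer\<close> it is still minimal, hence optimal.\<close>

lemma ex_rep_O:
  assumes Y: "Y \<in> rep_M P X"
  obtains Z where "Z \<in> rep_O P X" "ext_map X Z Y id"
proof -
  have YE: "Y \<in> EP" using Y by (simp add: rep_M_iff)
  define \<A> where "\<A> = {Collect (openin Z) |Z.
      Z \<in> EP \<and> topspace Z = topspace Y \<and> (\<forall>U. openin Y U \<longrightarrow> openin Z U)}"
  have "\<exists>M\<in>\<A>. \<forall>c\<in>\<A>. M \<subseteq> c \<longrightarrow> c = M"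
  proof (rule subset_Zorn)
    fix \<C> assume ch: "subset.chain \<A> \<C>"
    show "\<exists>u\<in>\<A>. \<forall>c\<in>\<C>. c \<subseteq> u"
    proof (cases "\<C> = {}")
      case True
      then show ?thesis
        using YE by (auto simp: \<A>_def)
    next
      case False
      obtain J where J: "J \<in> EP" "topspace J = topspace Y" "\<forall>U\<in>\<Union>\<C>. openin J U"
        by (rule EP_chain_join[OF YE False ch[unfolded \<A>_def]])
      obtain c where "c \<in> \<C>" using False by blast
      then have "c \<in> \<A>"
        using ch unfolding subset.chain_def by blast
      then have "U \<in> c" if "openin Y U" for U
        using that unfolding \<A>_def by blast
      then have "openin J U" if "openin Y U" for U
        using J(3) \<open>c \<in> \<C>\<close> that by (metis UnionI)
      then have "Collect (openin J) \<in> \<A>"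
        using J(1,2) unfolding \<A>_def by blast
      moreover have "c \<subseteq> Collect (openin J)" if "c \<in> \<C>" for c
        using J(3) that by (metis UnionI mem_Collect_eq subsetI)
      ultimately show ?thesis by blast
    qed
  qed
  then obtain M where M: "M \<in> \<A>" "\<And>c. c \<in> \<A> \<Longrightarrow> M \<subseteq> c \<Longrightarrow> c = M"
    by metis
  obtain Z where MZ: "M = Collect (openin Z)" and Z: "Z \<in> EP" "topspace Z = topspace Y"
      "\<And>U. openin Y U \<Longrightarrow> openin Z U"
    using M(1) unfolding \<A>_def by blast
  have "W = Z" if W: "W \<in> EP" "topspace W = topspace Z" "\<forall>U. openin Z U \<longrightarrow> openin W U" for W
  proof -
    have "Collect (openin W) \<in> \<A>"
      using W Z unfolding \<A>_def by blast
    then have "Collect (openin W) = Collect (openin Z)"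
      using M(2)[of "Collect (openin W)"] W(3) unfolding MZ by blast
    then show ?thesis
      unfolding topology_eq by blast
  qed
  then have "Z \<in> rep_O P X"
    using rep_M_finer[OF Y Z] unfolding rep_O_def by blast
  moreover have "ext_map X Z Y id"
    using continuous_map_id_finer[OF Z(2,3)] by (simp add: ext_map_def)
  ultimately show thesis
    using that by blast
qed

end

section \<open>The orders on classes of extensions\<close>

lemma compactness_like_closed_ideal:
  fixes P :: "'u topology \<Rightarrow> bool"
  assumes inf: "infinite (UNIV :: 'u set)" and P: "compactness_like P" and X: "Hausdorff_space X"
  shows "closed_ideal P X"
proof
  have P': "topological_property P" "clopen_hereditary P" "finitely_additive P" "perfect_invariant P"
    "perfect_inverse_invariant P" "mrowka_W P"
    using P by (auto simp: compactness_like_def perfect_property_def)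
  note hereditary = property_closed_subspace[OF inf P'(1,2,5)]
  show "P Y \<longleftrightarrow> (\<forall>C. closedin Y C \<longrightarrow> C \<subseteq> topspace X \<longrightarrow> P (subtopology X C))"
    if Y: "Y \<in> rep_E X" for Y
  proof
    show "\<forall>C. closedin Y C \<longrightarrow> C \<subseteq> topspace X \<longrightarrow> P (subtopology X C)" if "P Y"
      using hereditary[OF rep_E_D(4)[OF Y] that] rep_E_subtopology[OF Y] by metis
    assume C: "\<forall>C. closedin Y C \<longrightarrow> C \<subseteq> topspace X \<longrightarrow> P (subtopology X C)"
    show "P Y"
    proof (rule property_if_closed_disjoint[OF P'(5,6) rep_E_D(5,6)[OF Y]])
      fix D assume D: "closedin Y D" "D \<inter> (topspace Y - topspace X) = {}"
      then have "D \<subseteq> topspace X"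
        using closedin_subset[OF D(1)] by blast
      then show "P (subtopology Y D)"
        using C D(1) rep_E_subtopology[OF Y] by metis
    qed
  qed
  show "P (subtopology X C)"
    if "closedin X C" "closedin X D" "C \<subseteq> D" "P (subtopology X D)" for C D
  proof -
    have "subtopology (subtopology X D) C = subtopology X C"
      using that(3) by (simp add: subtopology_subtopology inf.absorb2)
    moreover have "closedin (subtopology X D) C"
      using that by (simp add: closedin_closed_subtopology)
    ultimately show ?thesis
      using hereditary[OF Hausdorff_space_subtopology[OF X] that(4)] by metis
  qed
  show "P (subtopology X (C \<union> D))"
    if "closedin X C" "closedin X D" "P (subtopology X C)" "P (subtopology X D)" for C D
    using property_union_closed[OF inf P'(3,4) X that(1,3,2,4)] .
qed

text \<open>Closed sets of \<open>Y\<close> inside \<open>X\<close> are closed in \<open>X\<close>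
  and so have \<open>Q\<close>; collapsing the compact remainder gives \<open>Q\<close> for
  \<open>Y\<close>.\<close>

lemma rep_E_inherits_property:
  fixes Q :: "'u topology \<Rightarrow> bool"
  assumes inf: "infinite (UNIV :: 'u set)" and Q: "topological_property Q" "clopen_hereditary Q"
    "perfect_inverse_invariant Q" "mrowka_W Q" and X: "Hausdorff_space X" "Q X" and Y: "Y \<in> rep_E X"
  shows "Q Y"
proof (rule property_if_closed_disjoint[OF Q(3,4) rep_E_D(5,6)[OF Y]])
  fix C assume C: "closedin Y C" "C \<inter> (topspace Y - topspace X) = {}"
  then have "C \<subseteq> topspace X"
    using closedin_subset[OF C(1)] by blast
  then show "Q (subtopology Y C)"
    using property_closed_subspace[OF inf Q(1-3) X rep_E_closedin[OF Y C(1)]] rep_E_subtopology[OF Y]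
    by metis
qed

section \<open>Orders on classes, read off on representatives\<close>

abbreviation ext_class :: "'u topology \<Rightarrow> 'u topology \<Rightarrow> 'u topology set" where
  "ext_class X Y \<equiv> ext_equiv X `` {Y}"

lemma ext_equiv_ext_map:
  assumes "(Y, Z) \<in> ext_equiv X"
  obtains h where "ext_map X Y Z h" "h ` topspace Y = topspace Z"
  using assms homeomorphic_imp_continuous_map homeomorphic_imp_surjective_map
  unfolding ext_equiv_def ext_map_def by blast

lemma ext_equiv_sym: "(Y, Z) \<in> ext_equiv X \<Longrightarrow> (Z, Y) \<in> ext_equiv X"
  using equiv_ext_equiv by (metis equivE symD)

lemma ext_class_self: "Y \<in> rep_E X \<Longrightarrow> Y \<in> ext_class X Y"
  using equiv_ext_equiv by (rule equiv_class_self)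

text \<open>Homeomorphisms fixing \<open>X\<close> translate between representatives, so a map
  between some of them yields one between all of them.\<close>

lemma ext_le_class_iff:
  assumes Y: "Y \<in> rep_E X" and Z: "Z \<in> rep_E X"
  shows "ext_le X (ext_class X Y) (ext_class X Z) \<longleftrightarrow> (\<exists>f. ext_map X Z Y f)"
proof
  assume "ext_le X (ext_class X Y) (ext_class X Z)"
  then obtain Y' Z' f where f: "(Y, Y') \<in> ext_equiv X" "(Z, Z') \<in> ext_equiv X" "ext_map X Z' Y' f"
    unfolding ext_le_def ext_map_def by blast
  obtain h where h: "ext_map X Z Z' h"
    using ext_equiv_ext_map[OF f(2)] by metis
  obtain k where k: "ext_map X Y' Y k"
    using ext_equiv_ext_map[OF ext_equiv_sym[OF f(1)]] by metis
  show "\<exists>f. ext_map X Z Y f"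
    using ext_map_compose[OF h ext_map_compose[OF f(3) k]] by blast
next
  assume "\<exists>f. ext_map X Z Y f"
  then show "ext_le X (ext_class X Y) (ext_class X Z)"
    using ext_class_self[OF Y] ext_class_self[OF Z] unfolding ext_le_def ext_map_def by blast
qed

lemma ext_le_surj_class_iff:
  assumes Y: "Y \<in> rep_E X" and Z: "Z \<in> rep_E X"
  shows "ext_le_surj X (ext_class X Y) (ext_class X Z) \<longleftrightarrow>
    (\<exists>f. ext_map X Z Y f \<and> f ` topspace Z = topspace Y)"
proof
  assume "ext_le_surj X (ext_class X Y) (ext_class X Z)"
  then obtain Y' Z' f where f: "(Y, Y') \<in> ext_equiv X" "(Z, Z') \<in> ext_equiv X" "ext_map X Z' Y' f"
      "f ` topspace Z' = topspace Y'"
    unfolding ext_le_surj_def ext_map_def by blast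
  obtain h where h: "ext_map X Z Z' h" "h ` topspace Z = topspace Z'"
    using ext_equiv_ext_map[OF f(2)] by metis
  obtain k where k: "ext_map X Y' Y k" "k ` topspace Y' = topspace Y"
    using ext_equiv_ext_map[OF ext_equiv_sym[OF f(1)]] by metis
  have "(k \<circ> f \<circ> h) ` topspace Z = topspace Y"
    unfolding image_comp[symmetric] h(2) f(4) k(2) ..
  then show "\<exists>f. ext_map X Z Y f \<and> f ` topspace Z = topspace Y"
    using ext_map_compose[OF h(1) ext_map_compose[OF f(3) k(1)]] by blast
next
  assume "\<exists>f. ext_map X Z Y f \<and> f ` topspace Z = topspace Y"
  then show "ext_le_surj X (ext_class X Y) (ext_class X Z)"
    using ext_class_self[OF Y] ext_class_self[OF Z] unfolding ext_le_surj_def ext_map_def by blast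
qed

section \<open>The four characterisations as pure order theory\<close>

text \<open>Separates the formal part from the topology: \<open>surj\<close> and
  \<open>proper\<close> drive the first and third claims, \<open>M_down\<close> and
  \<open>O_cofinal\<close> the second, and \<open>M_cofinal\<close>, \<open>M_down\<close> and
  \<open>surj\<close> the fourth.\<close>

lemma extremal_characterizations:
  fixes le les :: "'b \<Rightarrow> 'b \<Rightarrow> bool"
  assumes ME: "M \<subseteq> E" and OM: "Opt \<subseteq> M"
    and les_le: "\<And>S T. les S T \<Longrightarrow> le S T"
    and trans: "\<And>R S T. R \<in> E \<Longrightarrow> S \<in> E \<Longrightarrow> T \<in> E \<Longrightarrow> le R S \<Longrightarrow> le S T \<Longrightarrow> le R T"
    and surj: "\<And>S T. S \<in> M \<Longrightarrow> T \<in> E \<Longrightarrow> le S T \<Longrightarrow> les S T"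
    and proper: "\<And>S. S \<in> E \<Longrightarrow> S \<notin> M \<Longrightarrow> \<exists>R\<in>E. le S R \<and> (\<forall>T\<in>E. le R T \<longrightarrow> \<not> les S T)"
    and refl: "\<And>S. S \<in> E \<Longrightarrow> le S S"
    and M_cofinal: "\<And>S. S \<in> E \<Longrightarrow> \<exists>T\<in>M. le S T"
    and M_down: "\<And>S T. S \<in> E \<Longrightarrow> T \<in> M \<Longrightarrow> les S T \<Longrightarrow> S \<in> M"
    and O_cofinal: "\<And>S. S \<in> M \<Longrightarrow> \<exists>T\<in>Opt. le S T"
  shows "largest_set (\<lambda>A. cofinal_in le E A \<and> (\<forall>S\<in>A. \<forall>T\<in>A. le S T \<longleftrightarrow> les S T)) M"
    and "largest_set (\<lambda>A. A \<subseteq> E \<and> cofinal_in les A Opt) M"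
    and "largest_set (\<lambda>A. A \<subseteq> E \<and> (\<forall>S\<in>A. \<forall>T\<in>E. le S T \<longrightarrow> les S T)) M"
    and "smallest_set (\<lambda>A. cofinal_in le E A \<and> (\<forall>S\<in>E. \<forall>T\<in>A. les S T \<longrightarrow> S \<in> A)) M"
proof -
  have cof: "cofinal_in le E M"
    using ME M_cofinal by (auto simp: cofinal_in_def)
  show "largest_set (\<lambda>A. cofinal_in le E A \<and> (\<forall>S\<in>A. \<forall>T\<in>A. le S T \<longleftrightarrow> les S T)) M"
    unfolding largest_set_def
  proof (intro conjI allI impI cof ballI)
    fix S T assume "S \<in> M" "T \<in> M"
    then show "le S T \<longleftrightarrow> les S T"
      using les_le surj ME by blast
  next
    fix A assume A: "cofinal_in le E A \<and> (\<forall>S\<in>A. \<forall>T\<in>A. le S T \<longleftrightarrow> les S T)"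
    show "A \<subseteq> M"
    proof (intro subsetI, rule ccontr)
      fix S assume S: "S \<in> A" "S \<notin> M"
      then have SE: "S \<in> E" using A by (auto simp: cofinal_in_def)
      obtain R where R: "R \<in> E" "le S R" "\<forall>T\<in>E. le R T \<longrightarrow> \<not> les S T"
        using proper[OF SE S(2)] by blast
      \<comment> \<open>\<open>R\<close> may lie outside \<open>A\<close>, so cofinality supplies
        some \<open>T\<close> in \<open>A\<close> above it. Then \<open>le S T\<close> holds while
        \<open>les S T\<close> fails.\<close>
      obtain T where T: "T \<in> A" "T \<in> E" "le R T"
        using A R(1) unfolding cofinal_in_def by blast
      then have "le S T"
        using trans[OF SE R(1) T(2) R(2)] by blast
      then show False
        using A S(1) T R(3) by blast
    qed
  qed
  show "largest_set (\<lambda>A. A \<subseteq> E \<and> cofinal_in les A Opt) M"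
    unfolding largest_set_def cofinal_in_def
  proof (intro conjI allI impI ME OM ballI)
    show "\<exists>T\<in>Opt. les S T" if "S \<in> M" for S
      using O_cofinal[OF that] surj[OF that] OM ME by blast
    \<comment> \<open>Every element of \<open>A\<close> is \<open>les\<close>-below an element of
      \<open>Opt\<close>, which lies in \<open>M\<close>, and \<open>M\<close> is closed
      downwards.\<close>
    show "A \<subseteq> M" if "A \<subseteq> E \<and> Opt \<subseteq> A \<and> (\<forall>x\<in>A. \<exists>a\<in>Opt. les x a)" for A
      using that M_down OM by blast
  qed
  show "largest_set (\<lambda>A. A \<subseteq> E \<and> (\<forall>S\<in>A. \<forall>T\<in>E. le S T \<longrightarrow> les S T)) M"
    unfolding largest_set_def
  proof (intro conjI allI impI ME ballI)
    show "les S T" if "S \<in> M" "T \<in> E" "le S T" for S T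
      using surj that .
    show "A \<subseteq> M" if "A \<subseteq> E \<and> (\<forall>S\<in>A. \<forall>T\<in>E. le S T \<longrightarrow> les S T)" for A
    proof (intro subsetI, rule ccontr)
      fix S assume S: "S \<in> A" "S \<notin> M"
      then have "S \<in> E" using that by blast
      obtain R where "R \<in> E" "le S R" "\<forall>T\<in>E. le R T \<longrightarrow> \<not> les S T"
        using proper[OF \<open>S \<in> E\<close> S(2)] by blast
      then show False
        using that S(1) refl by blast
    qed
  qed
  show "smallest_set (\<lambda>A. cofinal_in le E A \<and> (\<forall>S\<in>E. \<forall>T\<in>A. les S T \<longrightarrow> S \<in> A)) M"
    unfolding smallest_set_def
  proof (intro conjI allI impI cof ballI)
    show "S \<in> M" if "S \<in> E" "T \<in> M" "les S T" for S T
      using M_down that .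
    fix A assume A: "cofinal_in le E A \<and> (\<forall>S\<in>E. \<forall>T\<in>A. les S T \<longrightarrow> S \<in> A)"
    show "M \<subseteq> A"
    proof
      fix S assume S: "S \<in> M"
      \<comment> \<open>Cofinality puts some \<open>T\<close> of \<open>A\<close> above
        \<open>S\<close>; minimality of \<open>S\<close> makes the relation surjective, and the
        closure of \<open>A\<close> then captures \<open>S\<close>.\<close>
      then obtain T where "T \<in> A" "T \<in> E" "le S T"
        using A ME unfolding cofinal_in_def by blast
      then show "S \<in> A"
        using A S ME surj by blast
    qed
  qed
qed

context closed_ideal
begin

lemma EP_rep_E: "Y \<in> EP \<Longrightarrow> Y \<in> rep_E X"
  by (simp add: EP_iff)

lemma M_EP: "Y \<in> rep_M P X \<Longrightarrow> Y \<in> EP"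
  by (simp add: rep_M_def)

lemma prop_classes:
  "E_prop P X = ext_class X ` EP" "M_prop P X = ext_class X ` rep_M P X"
  "O_prop P X = ext_class X ` rep_O P X"
  by (auto simp: E_prop_def M_prop_def O_prop_def quotient_def)

lemma ext_le_class:
  "Y \<in> EP \<Longrightarrow> Z \<in> EP \<Longrightarrow> ext_le X (ext_class X Y) (ext_class X Z) \<longleftrightarrow> (\<exists>f. ext_map X Z Y f)"
  "Y \<in> EP \<Longrightarrow> Z \<in> EP \<Longrightarrow> ext_le_surj X (ext_class X Y) (ext_class X Z) \<longleftrightarrow>
    (\<exists>f. ext_map X Z Y f \<and> f ` topspace Z = topspace Y)"
  using ext_le_class_iff ext_le_surj_class_iff EP_rep_E by blast+

text \<open>The facts 1 to 10 are the assumptions of \<open>extremal_characterizations\<close> in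
  order; those about the topology are transferred by choosing representatives.\<close>

lemma M_prop_extremal:
  defines "le \<equiv> ext_le X" and "les \<equiv> ext_le_surj X"
    and "E \<equiv> E_prop P X" and "M \<equiv> M_prop P X"
  shows "largest_set (\<lambda>A. cofinal_in le E A \<and> (\<forall>S\<in>A. \<forall>T\<in>A. le S T \<longleftrightarrow> les S T)) M"
    and "largest_set (\<lambda>A. A \<subseteq> E \<and> cofinal_in les A (O_prop P X)) M"
    and "largest_set (\<lambda>A. A \<subseteq> E \<and> (\<forall>S\<in>A. \<forall>T\<in>E. le S T \<longrightarrow> les S T)) M"
    and "smallest_set (\<lambda>A. cofinal_in le E A \<and> (\<forall>S\<in>E. \<forall>T\<in>A. les S T \<longrightarrow> S \<in> A)) M"
proof -
  have OM: "rep_O P X \<subseteq> rep_M P X"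
    by (auto simp: rep_O_def)
  have le_I: "le (ext_class X Y) (ext_class X Z)" if "Y \<in> EP" "Z \<in> EP" "ext_map X Z Y f" for Y Z f
    using that ext_le_class(1) unfolding le_def by blast
  have 1: "M \<subseteq> E"
    using M_EP unfolding M_def E_def prop_classes by blast
  have 2: "O_prop P X \<subseteq> M"
    using OM unfolding M_def prop_classes by blast
  have 3: "le S T" if les: "les S T" for S T
    using les unfolding le_def les_def ext_le_def ext_le_surj_def by blast
  have 4: "le R T" if "R \<in> E" "S \<in> E" "T \<in> E" "le R S" "le S T" for R S T
  proof -
    obtain U where U: "U \<in> EP" "R = ext_class X U"
      using \<open>R \<in> E\<close> unfolding E_def prop_classes by blast
    obtain V where V: "V \<in> EP" "S = ext_class X V"
      using \<open>S \<in> E\<close> unfolding E_def prop_classes by blast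
    obtain W where W: "W \<in> EP" "T = ext_class X W"
      using \<open>T \<in> E\<close> unfolding E_def prop_classes by blast
    obtain f where f: "ext_map X V U f"
      using \<open>le R S\<close> unfolding le_def U(2) V(2) ext_le_class(1)[OF U(1) V(1)] by blast
    obtain g where g: "ext_map X W V g"
      using \<open>le S T\<close> unfolding le_def V(2) W(2) ext_le_class(1)[OF V(1) W(1)] by blast
    from ext_map_compose[OF g f] show ?thesis
      unfolding U(2) W(2) by (rule le_I[OF U(1) W(1)])
  qed
  have 5: "les S T" if S: "S \<in> M" and T: "T \<in> E" and le: "le S T" for S T
  proof -
    obtain Y where Y: "Y \<in> rep_M P X" "S = ext_class X Y"
      using S unfolding M_def prop_classes by blast
    obtain Z where Z: "Z \<in> EP" "T = ext_class X Z"
      using T unfolding E_def prop_classes by blast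
    obtain f where f: "ext_map X Z Y f"
      using le unfolding le_def Y(2) Z(2) ext_le_class(1)[OF M_EP[OF Y(1)] Z(1)] by blast
    show ?thesis
      unfolding les_def Y(2) Z(2) ext_le_class(2)[OF M_EP[OF Y(1)] Z(1)]
      using f rep_M_ext_map_surj[OF Y(1) Z(1) f] by blast
  qed
  have 6: "\<exists>R\<in>E. le S R \<and> (\<forall>T\<in>E. le R T \<longrightarrow> \<not> les S T)" if S: "S \<in> E" "S \<notin> M" for S
  proof -
    obtain Y where Y: "Y \<in> EP" "S = ext_class X Y"
      using S(1) unfolding E_def prop_classes by blast
    then have "Y \<notin> rep_M P X"
      using S(2) unfolding M_def prop_classes by blast
    then obtain Z where Z: "Z \<in> EP" "ext_map X Z Y id"
      "\<And>T f. T \<in> EP \<Longrightarrow> ext_map X T Z f \<Longrightarrow> \<not> (\<exists>g. ext_map X T Y g \<and> g ` topspace T = topspace Y)"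
      using not_rep_M_proper_subspace[OF Y(1)] by metis
    have "\<not> les S T" if T: "T \<in> E" and le: "le (ext_class X Z) T" for T
    proof -
      obtain W where W: "W \<in> EP" "T = ext_class X W"
        using T unfolding E_def prop_classes by blast
      obtain f where f: "ext_map X W Z f"
        using le unfolding le_def W(2) ext_le_class(1)[OF Z(1) W(1)] by blast
      show ?thesis
        unfolding les_def Y(2) W(2) ext_le_class(2)[OF Y(1) W(1)] using Z(3)[OF W(1) f] .
    qed
    moreover have "ext_class X Z \<in> E" "le S (ext_class X Z)"
      using Z(1) le_I[OF Y(1) Z(1,2)] Y(2) unfolding E_def prop_classes by auto
    ultimately show ?thesis by blast
  qed
  have 7: "le S S" if S: "S \<in> E" for S
  proof -
    obtain Y where Y: "Y \<in> EP" "S = ext_class X Y"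
      using S unfolding E_def prop_classes by blast
    have "ext_map X Y Y id"
      by (simp add: ext_map_def)
    then show ?thesis
      unfolding Y(2) by (rule le_I[OF Y(1) Y(1)])
  qed
  have 8: "\<exists>T\<in>M. le S T" if S: "S \<in> E" for S
  proof -
    obtain Y where Y: "Y \<in> EP" "S = ext_class X Y"
      using S unfolding E_def prop_classes by blast
    obtain Z where Z: "Z \<in> rep_M P X" "ext_map X Z Y id"
      by (rule ex_rep_M[OF Y(1)])
    then show ?thesis
      using le_I[OF Y(1) M_EP[OF Z(1)] Z(2)] Y(2) unfolding M_def prop_classes by blast
  qed
  have 9: "S \<in> M" if S: "S \<in> E" and T: "T \<in> M" and les: "les S T" for S T
  proof -
    obtain Y where Y: "Y \<in> EP" "S = ext_class X Y"
      using S unfolding E_def prop_classes by blast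
    obtain Z where Z: "Z \<in> rep_M P X" "T = ext_class X Z"
      using T unfolding M_def prop_classes by blast
    obtain f where "ext_map X Z Y f" "f ` topspace Z = topspace Y"
      using les unfolding les_def Y(2) Z(2) ext_le_class(2)[OF Y(1) M_EP[OF Z(1)]] by blast
    then have "Y \<in> rep_M P X"
      by (rule rep_M_surj_image[OF Z(1) EP_rep_E[OF Y(1)]])
    then show ?thesis
      unfolding Y(2) M_def prop_classes by blast
  qed
  have 10: "\<exists>T\<in>O_prop P X. le S T" if S: "S \<in> M" for S
  proof -
    obtain Y where Y: "Y \<in> rep_M P X" "S = ext_class X Y"
      using S unfolding M_def prop_classes by blast
    obtain Z where Z: "Z \<in> rep_O P X" "ext_map X Z Y id"
      by (rule ex_rep_O[OF Y(1)])
    then have "Z \<in> EP" using OM M_EP by blast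
    then show ?thesis
      using le_I[OF M_EP[OF Y(1)] _ Z(2)] Y(2) Z(1) unfolding prop_classes by blast
  qed
  note main = extremal_characterizations[of M E "O_prop P X" les le, OF 1 2 3 4 5 6 7 8 9 10]
  show "largest_set (\<lambda>A. cofinal_in le E A \<and> (\<forall>S\<in>A. \<forall>T\<in>A. le S T \<longleftrightarrow> les S T)) M"
    by (rule main(1))
  show "largest_set (\<lambda>A. A \<subseteq> E \<and> cofinal_in les A (O_prop P X)) M"
    by (rule main(2))
  show "largest_set (\<lambda>A. A \<subseteq> E \<and> (\<forall>S\<in>A. \<forall>T\<in>E. le S T \<longrightarrow> les S T)) M"
    by (rule main(3))
  show "smallest_set (\<lambda>A. cofinal_in le E A \<and> (\<forall>S\<in>E. \<forall>T\<in>A. les S T \<longrightarrow> S \<in> A)) M"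
    by (rule main(4))
qed

end

theorem theorem4p8:
  fixes P Q :: "'u topology \<Rightarrow> bool" and X :: "'u topology"
  (* the universe is large enough to contain every Hausdorff extension of X and finite sums *)
  assumes universe: "infinite (UNIV :: 'u set)" "Pow (Pow (topspace X)) \<lesssim> (UNIV :: 'u set)"
    and pair: "compactness_like_pair P Q"
    and X: "tychonoff_space X" "Q X"
  shows "largest_set (\<lambda>A. cofinal_in (ext_le X) (E_pair P Q X) A \<and>
        (\<forall>S\<in>A. \<forall>T\<in>A. ext_le X S T \<longleftrightarrow> ext_le_surj X S T)) (M_pair P Q X) \<and>
     largest_set (\<lambda>A. A \<subseteq> E_pair P Q X \<and>
        cofinal_in (ext_le_surj X) A (O_pair P Q X)) (M_pair P Q X) \<and>
     largest_set (\<lambda>A. A \<subseteq> E_pair P Q X \<and>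
        (\<forall>S\<in>A. \<forall>T\<in>E_pair P Q X. ext_le X S T \<longrightarrow> ext_le_surj X S T)) (M_pair P Q X) \<and>
     smallest_set (\<lambda>A. cofinal_in (ext_le X) (E_pair P Q X) A \<and>
        (\<forall>S\<in>E_pair P Q X. \<forall>T\<in>A. ext_le_surj X S T \<longrightarrow> S \<in> A)) (M_pair P Q X)"
proof -
  have HX: "Hausdorff_space X"
    using X(1) by (simp add: tychonoff_space_def)
  have P: "compactness_like P" and Q: "topological_property Q" "clopen_hereditary Q"
    "perfect_inverse_invariant Q" "mrowka_W Q"
    using pair by (auto simp: compactness_like_pair_def)
  interpret closed_ideal P X
    using compactness_like_closed_ideal[OF universe(1) P HX] .
  \<comment> \<open>Every extension inherits \<open>Q\<close> from \<open>X\<close>, so intersecting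
    with the extensions that have \<open>Q\<close> changes none of the three sets.\<close>
  have "rep_E_prop Q X = rep_E X"
    using rep_E_inherits_property[OF universe(1) Q HX X(2)] by (auto simp: rep_E_prop_def)
  then have EQ: "E_prop Q X = ext_class X ` rep_E X"
    by (auto simp: E_prop_def quotient_def)
  have "EP \<subseteq> rep_E X" "rep_M P X \<subseteq> rep_E X" "rep_O P X \<subseteq> rep_E X"
    by (auto simp: rep_O_def rep_M_def rep_E_prop_def)
  then have eq: "E_pair P Q X = E_prop P X" "M_pair P Q X = M_prop P X" "O_pair P Q X = O_prop P X"
    unfolding E_pair_def M_pair_def O_pair_def EQ prop_classes by blast+
  show ?thesis
    unfolding eq by (intro conjI M_prop_extremal)
qed

end
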